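(* Let $n\ge 1$, $\gamma\in(0,1)$, $T>0$, $\tau>0$, $s>0$, $\theta>1$, and let $p>0$ satisfy $p+2\le s$. Let $l\in[0,p]$. Then there exists a constant $C>0$, independent of $\delta$, $E$ and $t$, such that the following holds for all $\delta>0$ and $E>0$. Let $u$ be the solution of the final value problem $\partial_t^\gamma u=\Delta u$ on $\mathbb{R}^n\times(0,T)$, $u(\cdot,T)=g$, with $u(\cdot,0)\in H^p(\mathbb{R}^n)$ and $\|u(\cdot,0)\|_{H^p}\le E$. Let $g^\delta\in L^2(\mathbb{R}^n)$ satisfy $\|g-g^\delta\|_{L^2}\le\delta$ and $0<\theta\delta<\|g^\delta\|_{L^2}$, let $u_\alpha^\delta$ be the regularized solution associated with $g^\delta$ and $\alpha>0$, and let $\alpha(\delta,g^\delta)>0$ be the parameter satisfying $$\Big\|\big(1-e^{-\tau(\alpha(\delta,g^\delta)|\xi|)^s}\big)\widehat{g^\delta}(\xi)\Big\|_{L^2}=\theta\delta .$$ Then $$\forall t\in[0,T],\qquad \big\|u(\cdot,t)-u_{\alpha(\delta,g^\delta)}^\delta(\cdot,t)\big\|_{H^l}\le C\,E^{\frac{2+l}{p+2}}\,\delta^{\frac{p-l}{p+2}}.$$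
   Context: The Fourier transform is $\widehat f(\xi)=(2\pi)^{-n/2}\int_{\mathbb{R}^n}f(x)e^{-ix\cdot\xi}\,dx$, and $\|f\|_{H^p}=\|(1+|\xi|^2)^{p/2}\widehat f\|_{L^2}$. $\partial_t^\gamma$ is the Caputo derivative $\partial_t^\gamma u(t)=\frac{1}{\Gamma(1-\gamma)}\int_0^t\frac{u'(r)}{(t-r)^\gamma}\,dr$. $E_{\gamma,1}(z)=\sum_{k\ge0}\frac{z^k}{\Gamma(\gamma k+1)}$ is the Mittag-Leffler function. A solution of $\partial_t^\gamma u=\Delta u$ is understood through its frequency representation $\widehat u(\xi,t)=\widehat u(\xi,0)\,E_{\gamma,1}(-|\xi|^2t^\gamma)$, $t\in[0,T]$ (transform in $x$); thus $\widehat g(\xi)=\widehat u(\xi,0)E_{\gamma,1}(-|\xi|^2T^\gamma)$ for $g=u(\cdot,T)$. The regularized solution $u_\alpha^\delta$ is defined by $$\widehat{u_\alpha^\delta}(\xi,t)=\frac{E_{\gamma,1}(-|\xi|^2t^\gamma)}{E_{\gamma,1}(-|\xi|^2T^\gamma)}\,e^{-\tau(\alpha|\xi|)^s}\,\widehat{g^\delta}(\xi),\qquad t\in[0,T].$$ Under the condition $0<\theta\delta<\|g^\delta\|_{L^2}$ the equation for $\alpha(\delta,g^\delta)$ has a unique solution. Here $E>0$ (a bound on the Sobolev norm) is not to be confused with the function $E_{\gamma,1}$. *)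

theory Defs
  imports "HOL-Analysis.Analysis"
begin

text \<open>
  Elements of \<open>L\<^sup>2\<close> are represented by Borel functions, and equations between them are read
  almost everywhere. Every class modulo null sets has a Borel representative.
\<close>

definition L2 :: "(real^'n \<Rightarrow> complex) set" where
  "L2 = {f \<in> borel_measurable lborel. integrable lborel (\<lambda>x. (cmod (f x))\<^sup>2)}"

definition L2_norm :: "(real^'n \<Rightarrow> complex) \<Rightarrow> real" where
  "L2_norm f = sqrt (LINT x|lborel. (cmod (f x))\<^sup>2)"

definition fourier_integral :: "(real^'n \<Rightarrow> complex) \<Rightarrow> real^'n \<Rightarrow> complex" where
  "fourier_integral f \<xi> =
     complex_of_real ((2 * pi) powr (- real CARD('n) / 2)) * (LINT x|lborel. cis (- (x \<bullet> \<xi>)) * f x)"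

text \<open>
  The integral need not converge for \<open>f\<close> in \<open>L\<^sup>2\<close>. There the transform is the \<open>L\<^sup>2\<close> limit of the
  transforms of the truncations of \<open>f\<close> to balls, which are integrable. The distance is measured
  by a nonnegative integral, so it is infinite when the difference is not square integrable.
\<close>

definition is_fourier_L2 :: "(real^'n \<Rightarrow> complex) \<Rightarrow> (real^'n \<Rightarrow> complex) \<Rightarrow> bool" where
  "is_fourier_L2 f F \<longleftrightarrow> F \<in> L2 \<and>
     ((\<lambda>R. \<integral>\<^sup>+ \<xi>. ennreal
          ((cmod (fourier_integral (\<lambda>x. indicator (cball 0 R) x * f x) \<xi> - F \<xi>))\<^sup>2) \<partial>lborel)
        \<longlongrightarrow> 0) at_top"

text \<open>
  The limit is unique only up to null sets, so a representative is chosen. For \<open>f\<close> in \<open>L\<^sup>2\<close> it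
  exists by Plancherel's theorem; outside \<open>L\<^sup>2\<close> the value is meaningless.
\<close>

definition fourier :: "(real^'n \<Rightarrow> complex) \<Rightarrow> real^'n \<Rightarrow> complex" where
  "fourier f = (SOME F. is_fourier_L2 f F)"

definition sobolev_weighted :: "real \<Rightarrow> (real^'n \<Rightarrow> complex) \<Rightarrow> real^'n \<Rightarrow> complex" where
  "sobolev_weighted p f = (\<lambda>\<xi>. complex_of_real ((1 + (norm \<xi>)\<^sup>2) powr (p / 2)) * fourier f \<xi>)"

text \<open>
  This is \<open>H\<^sup>p\<close> for \<open>p \<ge> 0\<close> only, where it is contained in \<open>L\<^sup>2\<close>. The real-valued norm is
  meaningful only together with membership.
\<close>

definition sobolev :: "real \<Rightarrow> (real^'n \<Rightarrow> complex) set" where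
  "sobolev p = {f \<in> L2. sobolev_weighted p f \<in> L2}"

definition sobolev_norm :: "real \<Rightarrow> (real^'n \<Rightarrow> complex) \<Rightarrow> real" where
  "sobolev_norm p f = L2_norm (sobolev_weighted p f)"

definition mittag_leffler :: "real \<Rightarrow> real \<Rightarrow> real \<Rightarrow> real" where
  "mittag_leffler a b z = (\<Sum>k. z ^ k / Gamma (a * real k + b))"

text \<open>
  Solutions of the time-fractional diffusion equation (order \<open>\<gamma>\<close>, Caputo) on \<open>[0,T]\<close>, understood
  through their frequency representation. The first argument of \<open>u\<close> is time.
\<close>

definition diffusion_solution ::
    "real \<Rightarrow> real \<Rightarrow> (real \<Rightarrow> real^'n \<Rightarrow> complex) \<Rightarrow> bool" where
  "diffusion_solution \<gamma> T u \<longleftrightarrow>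
     (\<forall>t\<in>{0..T}. u t \<in> L2 \<and>
        (AE \<xi> in lborel. fourier (u t) \<xi> =
           fourier (u 0) \<xi> * complex_of_real (mittag_leffler \<gamma> 1 (- (norm \<xi>)\<^sup>2 * t powr \<gamma>))))"

definition final_value_solution ::
    "real \<Rightarrow> real \<Rightarrow> (real^'n \<Rightarrow> complex) \<Rightarrow> (real \<Rightarrow> real^'n \<Rightarrow> complex) \<Rightarrow> bool" where
  "final_value_solution \<gamma> T g u \<longleftrightarrow>
     diffusion_solution \<gamma> T u \<and> (AE x in lborel. u T x = g x)"

text \<open>
  \<open>v\<close> is the regularized solution for the data \<open>h\<close> and the parameter \<open>\<alpha>\<close>. The condition
  determines each \<open>v t\<close> up to null sets.
\<close>

definition regularized_solution ::
    "real \<Rightarrow> real \<Rightarrow> real \<Rightarrow> real \<Rightarrow> real \<Rightarrow> (real^'n \<Rightarrow> complex) \<Rightarrow>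
     (real \<Rightarrow> real^'n \<Rightarrow> complex) \<Rightarrow> bool" where
  "regularized_solution \<gamma> T \<tau> s \<alpha> h v \<longleftrightarrow>
     (\<forall>t\<in>{0..T}. v t \<in> L2 \<and>
        (AE \<xi> in lborel. fourier (v t) \<xi> =
           complex_of_real (mittag_leffler \<gamma> 1 (- (norm \<xi>)\<^sup>2 * t powr \<gamma>)
                            / mittag_leffler \<gamma> 1 (- (norm \<xi>)\<^sup>2 * T powr \<gamma>)
                            * exp (- \<tau> * (\<alpha> * norm \<xi>) powr s))
           * fourier h \<xi>))"

end

theory Submission
  imports Defs "HOL-Probability.Probability"
begin

text \<open>
  On the Fourier side the error is \<open>E\<^sub>t ((1 - m) w + m (g - g\<^sub>\<delta>) / E\<^sub>T)\<close>, where \<open>w\<close> is the transform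
  of the initial value, \<open>m\<close> is the filter and \<open>E\<^sub>t\<close>, \<open>E\<^sub>T\<close> are the Mittag-Leffler factors.
  Since \<open>E\<^sub>T\<close> is comparable to \<open>1 / y\<close> with \<open>y = 1 + |\<xi>|\<^sup>2\<close>, the discrepancy equation bounds
  \<open>(1 - m) w\<close> by \<open>\<delta>\<close> in \<open>H\<^sup>-\<^sup>2\<close>, the source condition bounds it by \<open>E\<close> in \<open>H\<^sup>p\<close>, and interpolation
  gives \<open>H\<^sup>l\<close>. The same equation, with \<open>\<theta> > 1\<close> and \<open>p + 2 \<le> s\<close>, bounds \<open>\<alpha>\<close> from below, which controls
  the amplified noise \<open>m (g - g\<^sub>\<delta>) / E\<^sub>T\<close>.
\<close>

subsection \<open>Convolution of Mittag-Leffler kernels\<close>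

text \<open>At negative arguments the alternating series of \<open>mittag_leffler\<close> shows
  neither sign nor decay. Comparability with 1 / y is therefore drawn from integral equations for
  the kernels, and positivity has to precede both bounds. Likewise \<open>fourier\<close> is a
  choice among L2 limits, so existence, uniqueness and linearity up to null sets come before any
  estimate. The noise level \<delta> is measured in space, the discrepancy and the Sobolev norms in
  frequency; a norm inequality for the transform carries \<delta> across. The noise explains at most
  \<delta> of the discrepancy \<theta> \<delta>. The rest must come from (1 - m) h with exact data
  h, and this would be too small if \<alpha> were too small. Its smallness rests on 1 - m \<le>
  \<tau> (\<alpha> |\<xi>|)^s, which for \<alpha> |\<xi>| \<le> 1 gives the power p + 2 because p +
  2 \<le> s. The exponents of the claim arise from balancing N^(l+2) \<delta>^2 against N^(l-p) E^2,
  that is, from N^(p+2) = (E / \<delta>)^2.\<close>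

lemma Gamma_lower_bound:
  fixes x M :: real
  assumes "1 \<le> x" "0 < M"
  shows "M powr (x - 1) * exp (- M - 1) \<le> Gamma x"
proof -
  have G: "((\<lambda>t. t powr (x - 1) / exp t) has_integral Gamma x) {0..}"
    using Gamma_integral_real assms by simp
  have c: "((\<lambda>t::real. M powr (x - 1) * exp (- M - 1)) has_integral (M powr (x - 1) * exp (- M - 1))) {M..M+1}"
    using has_integral_const_real[of "M powr (x - 1) * exp (- M - 1)" M "M+1"] by simp
  \<comment> \<open>On the window from M to M + 1 both factors of the Gamma integrand are bounded
    below by an endpoint value. As M is free, Gamma outgrows every geometric sequence, which is what
    convergence of the series requires.\<close>
  have le: "M powr (x - 1) * exp (- M - 1) \<le> t powr (x - 1) / exp t" if "t \<in> {M..M+1}" for t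
  proof -
    have "M powr (x - 1) * exp (- M - 1) \<le> t powr (x - 1) * exp (- t)"
      using that assms by (intro mult_mono powr_mono2) auto
    then show ?thesis by (simp add: exp_minus field_simps)
  qed
  have int: "(\<lambda>t. t powr (x - 1) / exp t) integrable_on {M..M+1}"
    by (intro integrable_continuous_interval continuous_intros) (use assms in auto)
  have "M powr (x - 1) * exp (- M - 1) \<le> integral {M..M+1} (\<lambda>t. t powr (x - 1) / exp t)"
    using has_integral_le[OF c integrable_integral[OF int]] le by simp
  also have "\<dots> \<le> Gamma x"
    by (rule has_integral_subset_le[OF _ integrable_integral[OF int] G]) (use assms in auto)
  finally show ?thesis .
qed

lemma summable_mittag_leffler:
  fixes a b z :: real
  assumes "0 < a" "0 < b"
  shows "summable (\<lambda>k. \<bar>z\<bar> ^ k / Gamma (a * real k + b))"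
proof -
  \<comment> \<open>Chosen so that \<open>M powr a\<close> is 2 |z| + 1: dividing |z|^k by the Gamma
    bound leaves the ratio q < 1. The summand 1 keeps M positive at z = 0.\<close>
  define M where "M = (2 * \<bar>z\<bar> + 1) powr (1 / a)"
  define q where "q = \<bar>z\<bar> / (2 * \<bar>z\<bar> + 1)"
  define C where "C = exp (M + 1) * M powr (1 - b)"
  have M: "0 < M" "M powr a = 2 * \<bar>z\<bar> + 1"
    using assms by (auto simp: M_def powr_powr)
  have q: "0 \<le> q" "q < 1" by (auto simp: q_def field_simps)
  have "eventually (\<lambda>k::nat. 1 \<le> a * real k + b) sequentially"
  proof -
    have "filterlim (\<lambda>k::nat. a * real k + b) at_top sequentially"
      using assms by real_asymp
    then show ?thesis by (simp add: filterlim_at_top)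
  qed
  then have "eventually (\<lambda>k. norm (\<bar>z\<bar> ^ k / Gamma (a * real k + b)) \<le> C * q ^ k) sequentially"
  proof eventually_elim
    case (elim k)
    have pos: "0 < M powr (a * real k + b - 1) * exp (- M - 1)" using M by simp
    have low: "M powr (a * real k + b - 1) * exp (- M - 1) \<le> Gamma (a * real k + b)"
      by (rule Gamma_lower_bound[OF elim M(1)])
    have "norm (\<bar>z\<bar> ^ k / Gamma (a * real k + b)) = \<bar>z\<bar> ^ k / Gamma (a * real k + b)"
      using low pos by simp
    also have "\<dots> \<le> \<bar>z\<bar> ^ k / (M powr (a * real k + b - 1) * exp (- M - 1))"
      using low pos by (intro divide_left_mono mult_pos_pos) auto
    also have "M powr (a * real k + b - 1) = (M powr a) ^ k * M powr (b - 1)"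
      using M(1) by (simp add: powr_realpow[symmetric] powr_powr powr_add[symmetric] algebra_simps)
    also have "\<bar>z\<bar> ^ k / ((M powr a) ^ k * M powr (b - 1) * exp (- M - 1)) = C * q ^ k"
    proof -
      have "M powr (1 - b) = 1 / M powr (b - 1)"
        using powr_minus_divide[of M "b - 1"] by simp
      moreover have "exp (M + 1) = 1 / exp (- M - 1)"
        using exp_minus[of "- M - 1"] by (simp add: field_simps)
      ultimately show ?thesis using M
        by (simp add: C_def q_def power_divide)
    qed
    finally show ?case .
  qed
  then show ?thesis
    by (rule summable_comparison_test_ev) (use q in \<open>auto intro!: summable_mult summable_geometric\<close>)
qed

lemma Gamma_index_pos: "0 < a \<Longrightarrow> 0 < b \<Longrightarrow> 0 < Gamma (a * real k + b)" for a b :: real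
  by (intro Gamma_real_pos add_nonneg_pos) auto

lemma summable_mittag_leffler_signed:
  fixes a b z :: real
  assumes "0 < a" "0 < b"
  shows "summable (\<lambda>k. z ^ k / Gamma (a * real k + b))"
proof (rule summable_norm_cancel)
  have "norm (z ^ k / Gamma (a * real k + b)) = \<bar>z\<bar> ^ k / Gamma (a * real k + b)" for k
    using Gamma_index_pos[OF assms, of k] by (simp add: power_abs)
  then show "summable (\<lambda>k. norm (z ^ k / Gamma (a * real k + b)))"
    using summable_mittag_leffler[OF assms] by simp
qed

lemma isCont_mittag_leffler:
  fixes a b z :: real
  assumes "0 < a" "0 < b"
  shows "isCont (mittag_leffler a b) z"
proof -
  have "isCont (\<lambda>x. \<Sum>k. (1 / Gamma (a * real k + b)) * x ^ k) z"
    by (rule isCont_powser_converges_everywhere)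
       (use summable_mittag_leffler_signed[OF assms] in simp)
  then show ?thesis by (simp add: mittag_leffler_def[abs_def])
qed

lemma continuous_on_mittag_leffler [continuous_intros]:
  assumes "0 < a" "0 < b" "continuous_on S f"
  shows "continuous_on S (\<lambda>x. mittag_leffler a b (f x))"
  by (rule continuous_on_compose2[OF _ assms(3) subset_UNIV])
    (intro continuous_at_imp_continuous_on ballI isCont_mittag_leffler assms)

lemma mittag_leffler_0: "mittag_leffler a b 0 = 1 / Gamma b"
proof -
  have "(\<lambda>k. 0 ^ k / Gamma (a * real k + b)) sums (0 ^ 0 / Gamma (a * real 0 + b))"
    by (rule sums_finite[of "{0}", simplified]) auto
  then show ?thesis by (simp add: mittag_leffler_def sums_iff)
qed

text \<open>
  The kernels \<open>t\<^sup>a\<^sup>-\<^sup>1 E\<^sub>g\<^sub>,\<^sub>a(- t\<^sup>g)\<close> are closed under fractional integration. At \<open>t = 0\<close> the value is the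
  junk value \<open>0 powr (a - 1) = 0\<close>, even for \<open>a = 1\<close>.
\<close>

definition ml_kernel :: "real \<Rightarrow> real \<Rightarrow> real \<Rightarrow> real" where
  "ml_kernel g a t = t powr (a - 1) * mittag_leffler g a (- (t powr g))"

lemma ml_kernel_sums:
  assumes "0 < g" "0 < a" "0 < t"
  shows "(\<lambda>k. (- 1) ^ k * t powr (g * real k + a - 1) / Gamma (g * real k + a)) sums ml_kernel g a t"
proof -
  have "(\<lambda>k. (- (t powr g)) ^ k / Gamma (g * real k + a)) sums mittag_leffler g a (- (t powr g))"
    unfolding mittag_leffler_def by (rule summable_sums[OF summable_mittag_leffler_signed[OF assms(1,2)]])
  from sums_mult[OF this, of "t powr (a - 1)"] have
    "(\<lambda>k. t powr (a - 1) * ((- (t powr g)) ^ k / Gamma (g * real k + a))) sums ml_kernel g a t"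
    by (simp add: ml_kernel_def)
  moreover have "t powr (a - 1) * ((- (t powr g)) ^ k / Gamma (g * real k + a)) =
    (- 1) ^ k * t powr (g * real k + a - 1) / Gamma (g * real k + a)" for k
  proof -
    have "(- (t powr g)) ^ k = (- 1) ^ k * t powr (g * real k)"
      using assms by (simp add: power_minus[of "t powr g"] powr_realpow[symmetric] powr_powr)
    moreover have "t powr (g * real k + a - 1) = t powr (g * real k) * t powr (a - 1)"
      by (simp add: powr_add[symmetric] algebra_simps)
    ultimately show ?thesis by (simp add: mult_ac)
  qed
  ultimately show ?thesis by (simp only:)
qed

text \<open>Splitting off the term k = 0 raises the second index by g and flips the sign. Together
  with the convolution rule this becomes the Volterra equation of the kernel.\<close>

lemma ml_kernel_shift:
  assumes "0 < g" "0 < a" "0 < t"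
  shows "ml_kernel g a t = t powr (a - 1) / Gamma a - ml_kernel g (a + g) t"
proof -
  let ?f = "\<lambda>k. (- 1) ^ k * t powr (g * real k + a - 1) / Gamma (g * real k + a)"
  have "(\<lambda>k. - ((- 1) ^ k * t powr (g * real k + (a + g) - 1) / Gamma (g * real k + (a + g)))) sums - ml_kernel g (a + g) t"
    by (intro sums_minus ml_kernel_sums) (use assms in auto)
  also have "(\<lambda>k. - ((- 1) ^ k * t powr (g * real k + (a + g) - 1) / Gamma (g * real k + (a + g)))) = (\<lambda>k. ?f (Suc k))"
    by (auto simp: algebra_simps)
  finally have "?f sums (- ml_kernel g (a + g) t + ?f 0)"
    by (rule sums_Suc)
  with ml_kernel_sums[OF assms] have "ml_kernel g a t = - ml_kernel g (a + g) t + ?f 0"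
    by (rule sums_unique2)
  then show ?thesis by simp
qed

lemma Beta_convolution:
  fixes a c t :: real
  assumes "0 < a" "0 < c" "0 < t"
  shows "has_bochner_integral lborel (\<lambda>s. indicator {0..t} s * ((t - s) powr (c - 1) * s powr (a - 1)))
           (Beta a c * t powr (a + c - 1))"
proof -
  have 1: "has_bochner_integral lborel (\<lambda>x. indicator {0..1} x * (x powr (a - 1) * (1 - x) powr (c - 1))) (Beta a c)"
    using integrable_Beta[OF assms(1,2)] set_borel_integral_eq_integral[OF integrable_Beta[OF assms(1,2)]]
      has_integral_Beta_real[OF assms(1,2)]
    by (auto simp: has_bochner_integral_iff set_integrable_def set_lebesgue_integral_def has_integral_iff)
  have "has_bochner_integral lborel (\<lambda>s. indicator {0..t} s * ((t - s) powr (c - 1) * s powr (a - 1)))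
           (\<bar>t\<bar> *\<^sub>R (t powr (a + c - 2) * Beta a c))"
  proof (subst lborel_has_bochner_integral_real_affine_iff[of t _ _ 0])
    have "indicator {0..t} (t * x) * ((t - t * x) powr (c - 1) * (t * x) powr (a - 1)) =
       t powr (a + c - 2) * (indicator {0..1} x * (x powr (a - 1) * (1 - x) powr (c - 1)))" for x
    proof (cases "x \<in> {0..1}")
      case True
      have "t powr (a + c - 2) = t powr (c - 1) * t powr (a - 1)"
        by (simp add: powr_add[symmetric] add.commute)
      moreover have "(t - t * x) = t * (1 - x)" by (simp add: algebra_simps)
      moreover have "(t * (1 - x)) powr (c - 1) = t powr (c - 1) * (1 - x) powr (c - 1)"
        by (rule powr_mult)
      moreover have "(t * x) powr (a - 1) = t powr (a - 1) * x powr (a - 1)"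
        by (rule powr_mult)
      moreover have "t * x \<in> {0..t}"
        using True assms by (auto simp: mult_left_le)
      ultimately show ?thesis using True by simp
    next
      case False
      then have "t * x \<notin> {0..t}" using assms by (auto simp: zero_le_mult_iff)
      then show ?thesis using False by simp
    qed
    then show "has_bochner_integral lborel
     (\<lambda>x. indicator {0..t} (0 + t * x) * ((t - (0 + t * x)) powr (c - 1) * (0 + t * x) powr (a - 1)))
     ((\<bar>t\<bar> *\<^sub>R (t powr (a + c - 2) * Beta a c)) /\<^sub>R \<bar>t\<bar>)"
      using has_bochner_integral_mult_right[where c = "t powr (a + c - 2)", OF 1] assms
      by (simp add: mult.assoc[symmetric])
  qed (use assms in auto)
  moreover have "\<bar>t\<bar> *\<^sub>R (t powr (a + c - 2) * Beta a c) = Beta a c * t powr (a + c - 1)"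
    using assms powr_mult_base[of t "a + c - 2"] by (simp add: algebra_simps)
  ultimately show ?thesis by (simp only:)
qed

text \<open>Term by term, \<open>Beta (b k) c / Gamma (b k)\<close> equals
  \<open>Gamma c / Gamma (b k + c)\<close>, so convolution with a power raises the second index by
  c. Sum and integral may be exchanged because the integrals of the absolute values form a
  Mittag-Leffler series at a positive argument.\<close>

lemma ml_kernel_convolution:
  assumes "0 < g" "0 < a" "0 < c" "0 < t"
  shows "has_bochner_integral lborel (\<lambda>s. indicator {0..t} s * ((t - s) powr (c - 1) * ml_kernel g a s))
           (Gamma c * ml_kernel g (a + c) t)"
proof -
  define b where "b k = g * real k + a" for k
  have b: "0 < b k" for k using assms by (auto simp: b_def intro: add_nonneg_pos)
  define f where "f k s = indicator {0..t} s * ((t - s) powr (c - 1) * ((- 1) ^ k * s powr (b k - 1) / Gamma (b k)))" for k s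
  have nf: "norm (f k s) = (indicator {0..t} s * ((t - s) powr (c - 1) * s powr (b k - 1))) / Gamma (b k)" for k s
    using b[of k] by (simp add: f_def abs_mult power_abs)
  have Bf: "has_bochner_integral lborel (f k) ((- 1) ^ k * Gamma c * t powr (g * real k + (a + c) - 1) / Gamma (g * real k + (a + c)))" for k
  proof -
    have "has_bochner_integral lborel (\<lambda>s. ((- 1) ^ k / Gamma (b k)) * (indicator {0..t} s * ((t - s) powr (c - 1) * s powr (b k - 1))))
       (((- 1) ^ k / Gamma (b k)) * (Beta (b k) c * t powr (b k + c - 1)))"
      by (intro has_bochner_integral_mult_right Beta_convolution) (use b assms in auto)
    moreover have "Beta (b k) c = Gamma (b k) * Gamma c / Gamma (b k + c)"
      by (simp add: Beta_def)
    moreover have "((- 1) ^ k / Gamma (b k)) * (Gamma (b k) * Gamma c / Gamma (b k + c) * t powr (b k + c - 1)) =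
        (- 1) ^ k * Gamma c * t powr (g * real k + (a + c) - 1) / Gamma (g * real k + (a + c))"
      using Gamma_real_pos[OF b[of k]] by (simp add: b_def add_ac)
    moreover have "(\<lambda>s. ((- 1) ^ k / Gamma (b k)) * (indicator {0..t} s * ((t - s) powr (c - 1) * s powr (b k - 1)))) = f k"
      by (auto simp: f_def)
    ultimately show ?thesis by (simp only:)
  qed
  have Nf: "integral\<^sup>L lborel (\<lambda>s. norm (f k s)) = Gamma c * t powr (a + c - 1) * (\<bar>t powr g\<bar> ^ k / Gamma (g * real k + (a + c)))" for k
  proof -
    have "integral\<^sup>L lborel (\<lambda>s. norm (f k s)) = (Beta (b k) c * t powr (b k + c - 1)) / Gamma (b k)"
      unfolding nf using Beta_convolution[OF b[of k] assms(3,4)]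
      by (simp add: has_bochner_integral_iff)
    also have "\<dots> = Gamma c * t powr (a + c - 1) * ((t powr g) ^ k / Gamma (g * real k + (a + c)))"
      using Gamma_real_pos[OF b[of k]] assms
      by (simp add: Beta_def b_def powr_realpow[symmetric] powr_powr powr_add[symmetric] field_simps)
    finally show ?thesis by simp
  qed
  have int: "integrable lborel (f k)" for k using Bf by (auto simp: has_bochner_integral_iff)
  have sf: "(\<lambda>k. f k s) sums (indicator {0..t} s * ((t - s) powr (c - 1) * ml_kernel g a s))" if "s \<noteq> 0" for s
  proof (cases "s \<in> {0..t}")
    case True
    then have "(\<lambda>k. (- 1) ^ k * s powr (b k - 1) / Gamma (b k)) sums ml_kernel g a s"
      using ml_kernel_sums[of g a s] assms that unfolding b_def by simp
    then show ?thesis unfolding f_def by (intro sums_mult)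
  qed (simp add: f_def)
  have snf: "summable (\<lambda>k. norm (f k s))" if "s \<noteq> 0" for s
  proof (cases "s \<in> {0..t}")
    case True
    then have s: "0 < s" using that by auto
    have "norm (f k s) = (t - s) powr (c - 1) * s powr (a - 1) * (\<bar>s powr g\<bar> ^ k / Gamma (g * real k + a))" for k
      unfolding nf using True s by (simp add: b_def powr_realpow[symmetric] powr_powr powr_add[symmetric] algebra_simps)
    then show ?thesis by (simp only:) (intro summable_mult summable_mittag_leffler assms)
  qed (simp add: f_def)
  have ae: "AE s in lborel. s \<noteq> (0::real)" by (rule AE_lborel_singleton)
  have a1: "AE s in lborel. summable (\<lambda>k. norm (f k s))" using ae by eventually_elim (rule snf)
  have a2: "summable (\<lambda>k. integral\<^sup>L lborel (\<lambda>s. norm (f k s)))"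
    unfolding Nf by (intro summable_mult summable_mittag_leffler) (use assms in auto)
  have H: "has_bochner_integral lborel (\<lambda>s. \<Sum>k. f k s) (\<Sum>k. integral\<^sup>L lborel (f k))"
    using integrable_suminf[OF int a1 a2] integral_suminf[OF int a1 a2] by (simp add: has_bochner_integral_iff)
  have "(\<lambda>k. integral\<^sup>L lborel (f k)) sums (Gamma c * ml_kernel g (a + c) t)"
    using sums_mult[OF ml_kernel_sums[of g "a + c" t], of "Gamma c"] Bf assms
    by (simp add: has_bochner_integral_iff mult_ac)
  then have v: "(\<Sum>k. integral\<^sup>L lborel (f k)) = Gamma c * ml_kernel g (a + c) t" by (simp add: sums_iff)
  have meas: "(\<lambda>s. indicator {0..t} s * ((t - s) powr (c - 1) * ml_kernel g a s)) \<in> borel_measurable lborel"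
  proof -
    have "mittag_leffler g a \<in> borel_measurable borel"
      using assms by (intro borel_measurable_continuous_onI continuous_at_imp_continuous_on) (auto intro: isCont_mittag_leffler)
    then show ?thesis unfolding ml_kernel_def[abs_def] by measurable
  qed
  show ?thesis
    unfolding v[symmetric]
  proof (rule has_bochner_integral_cong_AE[THEN iffD1, OF _ _ _ H])
    show "AE s in lborel. (\<Sum>k. f k s) = indicator {0..t} s * ((t - s) powr (c - 1) * ml_kernel g a s)"
      using ae by eventually_elim (use sf in \<open>auto simp: sums_iff\<close>)
  qed (use H meas in \<open>auto intro: has_bochner_integral_integrable borel_measurable_integrable simp: has_bochner_integral_iff\<close>)
qed

subsection \<open>Two-sided bounds for the Mittag-Leffler function\<close>

lemma has_bochner_integral_mono_AE:
  fixes f g :: "'a \<Rightarrow> real"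
  assumes "has_bochner_integral M f a" "has_bochner_integral M g b" "AE x in M. f x \<le> g x"
  shows "a \<le> b"
  using assms integral_mono_AE[of M f g] by (auto simp: has_bochner_integral_iff)


lemma Gamma_real_plus1: "0 < x \<Longrightarrow> Gamma (1 + x) = x * Gamma x" for x :: real
  using Gamma_plus1[of x] nonpos_Ints_nonpos[of x] by (auto simp: add.commute)

lemma powr_kernel_integral:
  fixes a c t :: real
  assumes "0 < c" "a < t"
  shows "has_bochner_integral lborel (\<lambda>s. indicator {a..t} s * (t - s) powr (c - 1)) ((t - a) powr c / c)"
proof -
  have B: "Beta 1 c = 1 / c"
    using assms Gamma_real_plus1[of c] less_imp_neq[OF Gamma_real_pos[of c]] by (simp add: Beta_def)
  have "has_bochner_integral lborel (\<lambda>s. indicator {0..t-a} s * (t - a - s) powr (c - 1)) ((t - a) powr c / c)"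
  proof (rule has_bochner_integral_cong_AE[THEN iffD1])
    show "has_bochner_integral lborel (\<lambda>s. indicator {0..t-a} s * ((t - a - s) powr (c - 1) * s powr (1 - 1))) ((t - a) powr c / c)"
      using Beta_convolution[of 1 c "t - a"] assms B by simp
    \<comment> \<open>Since \<open>0 powr 0\<close> is 0, the factor \<open>s powr (1 - 1)\<close>
      is 1 everywhere except at s = 0.\<close>
    have "AE s in lborel. s \<noteq> (0::real)" by (rule AE_lborel_singleton)
    then show "AE s in lborel. indicator {0..t-a} s * ((t - a - s) powr (c - 1) * s powr (1 - 1)) = indicator {0..t-a} s * (t - a - s) powr (c - 1)"
      by eventually_elim auto
  qed auto
  moreover have "indicator {a..t} (a + 1 * s) * (t - (a + 1 * s)) powr (c - 1) = indicator {0..t-a} s * (t - a - s) powr (c - 1)" for s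
    by (auto simp: indicator_def algebra_simps)
  ultimately show ?thesis
    by (subst lborel_has_bochner_integral_real_affine_iff[of 1 _ _ a]) auto
qed

text \<open>
  \<open>r = ml_kernel g g\<close> solves the Volterra equation \<open>\<Gamma>(g) r = k - k * r\<close> with \<open>k(t) = t\<^sup>g\<^sup>-\<^sup>1\<close>. At a first
  zero \<open>t0\<close>, log-convexity of \<open>k\<close> compares the equation at \<open>t0\<close> with the one at a slightly earlier
  \<open>t1\<close>, chosen as a maximum point of \<open>r\<close> just before \<open>t0\<close>; the remaining part of the convolution is
  too small to cancel the positive term \<open>r t1\<close>.
\<close>

lemma ml_kernel_pos:
  assumes g: "0 < g" "g < 1" and t: "0 < t"
  shows "0 < ml_kernel g g t"
proof (rule ccontr)
  assume neg: "\<not> 0 < ml_kernel g g t"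
  \<comment> \<open>With the singular power split off, e is continuous up to 0 and positive there,
    so its zeros in [0, t] have a positive least element.\<close>
  define e where "e s = mittag_leffler g g (- (s powr g))" for s
  define r where "r = ml_kernel g g"
  have r: "r s = s powr (g - 1) * e s" for s by (simp add: r_def ml_kernel_def e_def)
  have ce: "continuous_on {0..} e" unfolding e_def
    by (intro continuous_intros g continuous_on_powr') (use g in auto)
  have G: "0 < Gamma g" using g by (simp add: Gamma_real_pos)
  have e0: "0 < e 0" using G by (simp add: e_def mittag_leffler_0)
  have et: "e t \<le> 0" using neg t by (simp add: r[unfolded r_def] zero_less_mult_iff not_less)
  define Z where "Z = {s \<in> {0..t}. e s = 0}"
  have "\<exists>s\<ge>0. s \<le> t \<and> e s = 0"
    by (rule IVT2') (use e0 et t continuous_on_subset[OF ce] in auto)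
  then have Zne: "Z \<noteq> {}" by (auto simp: Z_def)
  have Zcl: "closed Z" unfolding Z_def
    by (intro continuous_closed_preimage_constant continuous_on_subset[OF ce]) auto
  define t0 where "t0 = Inf Z"
  have bb: "bdd_below Z" by (auto simp: Z_def bdd_below_def)
  have t0Z: "t0 \<in> Z" unfolding t0_def by (intro closed_contains_Inf Zne Zcl bb)
  then have t0: "e t0 = 0" "0 \<le> t0" "t0 \<le> t" by (auto simp: Z_def)
  have t0p: "0 < t0" using t0 e0 by (cases "t0 = 0") auto
  have epos: "0 < e s" if "0 \<le> s" "s < t0" for s
  proof (rule ccontr)
    assume "\<not> 0 < e s"
    then have "\<exists>x\<ge>0. x \<le> s \<and> e x = 0"
      by (intro IVT2') (use e0 that continuous_on_subset[OF ce] in auto)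
    then obtain x where "0 \<le> x" "x \<le> s" "e x = 0" by auto
    then have "x \<in> Z" using that t0 by (auto simp: Z_def)
    then have "t0 \<le> x" unfolding t0_def by (intro cInf_lower bb)
    with \<open>x \<le> s\<close> that show False by simp
  qed
  have rpos: "0 < r s" if "0 < s" "s < t0" for s using epos[of s] that by (simp add: r)
  \<comment> \<open>The two bounds on the window are set to contradict each other:
    \<open>h \<le> t0 / 2\<close> will force q \<ge> 1/2, and
    \<open>h powr g \<le> Gamma g * g / 4\<close> will force q \<le> 1/4.\<close>
  define h where "h = min (t0 / 2) ((Gamma g * g / 4) powr (1 / g))"
  have h: "0 < h" "h \<le> t0 / 2" using t0p g less_imp_neq[OF G] by (auto simp: h_def)
  have hg: "h powr g \<le> Gamma g * g / 4"
  proof -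
    have "h powr g \<le> ((Gamma g * g / 4) powr (1 / g)) powr g"
      using h g by (intro powr_mono2) (auto simp: h_def)
    then show ?thesis using g G by (simp add: powr_powr)
  qed
  have cr: "continuous_on {t0 - h..t0} r"
    unfolding r[abs_def] using h t0p
    by (intro continuous_intros continuous_on_subset[OF ce]) auto
  obtain t1 where t1: "t1 \<in> {t0 - h..t0}" and max: "\<And>s. s \<in> {t0 - h..t0} \<Longrightarrow> r s \<le> r t1"
    using continuous_attains_sup[OF _ _ cr] h by auto
  have r0: "r t0 = 0" by (simp add: r t0)
  have "0 < r (t0 - h)" using rpos[of "t0 - h"] h t0p by auto
  also have "\<dots> \<le> r t1" using max h by auto
  finally have r1: "0 < r t1" .
  then have t1lt: "t1 < t0" using t1 r0 by (cases "t1 = t0") auto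
  have t1p: "0 < t1" "t0 / 2 \<le> t1" using t1 h t0p by auto
  have eq: "Gamma g * r x = x powr (g - 1) - Gamma g * ml_kernel g (g + g) x" if "0 < x" for x
    using ml_kernel_shift[of g g x] that g G unfolding r_def by (simp add: field_simps)
  \<comment> \<open>The ratio of the forcing terms of the Volterra equation at t0 and t1; scaling
    the equation at t1 by q makes them cancel in the comparison.\<close>
  define q where "q = t0 powr (g - 1) / t1 powr (g - 1)"
  note J0 = ml_kernel_convolution[of g g g t0, folded r_def, OF g(1) g(1) g(1) t0p]
  note J1 = ml_kernel_convolution[of g g g t1, folded r_def, OF g(1) g(1) g(1) t1p(1)]
  note K = powr_kernel_integral[OF g(1) t1lt]
  have le: "Gamma g * ml_kernel g (g + g) t0 \<le> q * (Gamma g * ml_kernel g (g + g) t1) + r t1 * ((t0 - t1) powr g / g)"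
  proof (rule has_bochner_integral_mono_AE)
    show "has_bochner_integral lborel (\<lambda>s. q * (indicator {0..t1} s * ((t1 - s) powr (g - 1) * r s)) + r t1 * (indicator {t1..t0} s * (t0 - s) powr (g - 1)))
      (q * (Gamma g * ml_kernel g (g + g) t1) + r t1 * ((t0 - t1) powr g / g))"
      by (intro has_bochner_integral_add has_bochner_integral_mult_right J1 K)
    have "AE s in lborel. s \<noteq> (0::real)" "AE s in lborel. s \<noteq> t1" by (rule AE_lborel_singleton)+
    then show "AE s in lborel. indicator {0..t0} s * ((t0 - s) powr (g - 1) * r s) \<le>
       q * (indicator {0..t1} s * ((t1 - s) powr (g - 1) * r s)) + r t1 * (indicator {t1..t0} s * (t0 - s) powr (g - 1))"
    proof eventually_elim
      case (elim s)
      consider "s < 0 \<or> t0 < s" | "0 < s" "s < t1" | "t1 < s" "s \<le> t0" using elim by linarith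
      then show ?case
      proof cases
        case 1
        then show ?thesis using t1lt t1p by (auto simp: indicator_def)
      next
        case 2
        \<comment> \<open>Here (t0 - s) t1 \<ge> t0 (t1 - s) while g - 1 is negative, so k(t0 - s) /
          k(t1 - s) is at most k(t0) / k(t1), which is q.\<close>
        have "((t0 - s) * t1) powr (g - 1) \<le> (t0 * (t1 - s)) powr (g - 1)"
          using 2 t1lt t0p g by (intro powr_mono2') (auto simp: algebra_simps)
        then have "(t0 - s) powr (g - 1) * t1 powr (g - 1) \<le> t0 powr (g - 1) * (t1 - s) powr (g - 1)"
          using 2 t1lt t0p by (simp add: powr_mult)
        then have "(t0 - s) powr (g - 1) \<le> q * (t1 - s) powr (g - 1)"
          using t1p by (simp add: q_def field_simps)
        then have "(t0 - s) powr (g - 1) * r s \<le> q * (t1 - s) powr (g - 1) * r s"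
          using rpos[of s] 2 t1lt by (intro mult_right_mono) auto
        then show ?thesis using 2 t1lt by (simp add: mult_ac)
      next
        case 3
        have "r s \<le> r t1" using 3 t1 by (intro max) auto
        then have "(t0 - s) powr (g - 1) * r s \<le> (t0 - s) powr (g - 1) * r t1" by (intro mult_left_mono) auto
        then show ?thesis using 3 t1p by (simp add: mult_ac)
      qed
    qed
  qed (rule J0)
  have "Gamma g * ml_kernel g (g + g) t0 = t0 powr (g - 1)" using eq[OF t0p] r0 by simp
  moreover have "q * (Gamma g * ml_kernel g (g + g) t1) = t0 powr (g - 1) - q * Gamma g * r t1"
  proof -
    have "Gamma g * ml_kernel g (g + g) t1 = t1 powr (g - 1) - Gamma g * r t1" using eq[OF t1p(1)] by simp
    then have "q * (Gamma g * ml_kernel g (g + g) t1) = q * t1 powr (g - 1) - q * Gamma g * r t1"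
      by (simp only:) (simp add: algebra_simps)
    then show ?thesis using t1p by (simp add: q_def)
  qed
  ultimately have "q * Gamma g * r t1 \<le> (t0 - t1) powr g / g * r t1" using le by (simp add: mult_ac)
  then have A: "q * Gamma g \<le> (t0 - t1) powr g / g" using r1 by (rule mult_right_le_imp_le)
  have "(t0 - t1) powr g / g \<le> h powr g / g"
    using t1 t1lt g by (intro divide_right_mono powr_mono2) auto
  also have "\<dots> \<le> Gamma g / 4" using hg g by (simp add: field_simps)
  finally have "q * Gamma g \<le> (1 / 4) * Gamma g" using A by linarith
  then have q4: "q \<le> 1 / 4" using G by (rule mult_right_le_imp_le)
  have "(t1 / t0) powr 1 \<le> (t1 / t0) powr (1 - g)"
    using t1p t1lt g by (intro powr_mono') auto
  also have "(t1 / t0) powr (1 - g) = t1 powr (1 - g) / t0 powr (1 - g)"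
    by (rule powr_divide)
  also have "\<dots> = q"
    using t1p t0p powr_minus_divide[of t1 "1 - g"] powr_minus_divide[of t0 "1 - g"] by (simp add: q_def)
  finally have "t1 / t0 \<le> q" using t1p t0p by simp
  moreover have "1 / 2 \<le> t1 / t0" using t1p t0p by (simp add: field_simps)
  ultimately have "1 / 2 \<le> q" by linarith
  with q4 show False by simp
qed

text \<open>
  Writing \<open>\<phi>\<close> for \<open>ml_kernel g 1\<close>, \<open>r\<close> for \<open>ml_kernel g g\<close> and \<open>*\<close> for convolution, both bounds come
  from monotonicity under the integral sign in \<open>1 - \<phi> = 1 * r\<close>, \<open>\<Gamma>(1 - g) \<phi> = t\<^sup>-\<^sup>g * r\<close> and \<open>\<Gamma>(g) (1 - \<phi>) = t\<^sup>g\<^sup>-\<^sup>1 * \<phi>\<close>.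
\<close>

lemma ml_kernel_1_bounds:
  assumes g: "0 < g" "g < 1" and t: "0 < t"
  defines "\<phi> \<equiv> ml_kernel g 1"
  shows "1 / (1 + Gamma (1 - g) * t powr g) \<le> \<phi> t" "\<phi> t \<le> 1 / (1 + t powr g / Gamma (1 + g))"
proof -
  define r where "r = ml_kernel g g"
  have rnn: "0 \<le> r s" if "0 \<le> s" for s
    using ml_kernel_pos[OF g, of s] that by (cases "s = 0") (auto simp: r_def ml_kernel_def)
  have shift: "\<phi> t = 1 - ml_kernel g (1 + g) t" if "0 < t" for t
    using ml_kernel_shift[of g 1 t] that g by (simp add: \<phi>_def)
  have int_r: "has_bochner_integral lborel (\<lambda>s. indicator {0..t} s * r s) (1 - \<phi> t)" if t: "0 < t" for t
  proof (rule has_bochner_integral_cong_AE[THEN iffD1])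
    show H: "has_bochner_integral lborel (\<lambda>s. indicator {0..t} s * ((t - s) powr (1 - 1) * r s)) (1 - \<phi> t)"
      using ml_kernel_convolution[of g g 1 t] t g by (simp add: shift r_def add.commute)
    have "AE s in lborel. s \<noteq> (t::real)" by (rule AE_lborel_singleton)
    then show "AE s in lborel. indicator {0..t} s * ((t - s) powr (1 - 1) * r s) = indicator {0..t} s * r s"
      by eventually_elim auto
    have "mittag_leffler g g \<in> borel_measurable borel"
      using g by (intro borel_measurable_continuous_onI continuous_at_imp_continuous_on) (auto intro: isCont_mittag_leffler)
    then show "(\<lambda>s. indicator {0..t} s * r s) \<in> borel_measurable lborel"
      unfolding r_def ml_kernel_def[abs_def] by measurable
    show "(\<lambda>s. indicator {0..t} s * ((t - s) powr (1 - 1) * r s)) \<in> borel_measurable lborel"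
      using H by (auto simp: has_bochner_integral_iff)
  qed
  have anti: "\<phi> t \<le> \<phi> s" if "0 < s" "s \<le> t" for s t
  proof -
    have "1 - \<phi> s \<le> 1 - \<phi> t"
      by (rule has_bochner_integral_mono_AE[OF int_r int_r])
         (use that rnn in \<open>auto simp: indicator_def\<close>)
    then show ?thesis by simp
  qed
  have low: "t powr (- g) * (1 - \<phi> t) \<le> Gamma (1 - g) * \<phi> t"
  proof (rule has_bochner_integral_mono_AE)
    show "has_bochner_integral lborel (\<lambda>s. indicator {0..t} s * ((t - s) powr (1 - g - 1) * r s)) (Gamma (1 - g) * \<phi> t)"
      using ml_kernel_convolution[of g g "1 - g" t] t g by (simp add: \<phi>_def r_def)
    show "has_bochner_integral lborel (\<lambda>s. t powr (- g) * (indicator {0..t} s * r s)) (t powr (- g) * (1 - \<phi> t))"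
      by (intro has_bochner_integral_mult_right int_r t)
    \<comment> \<open>At s = t the weight \<open>(t - s) powr (1 - g - 1)\<close> takes the default
      value 0, and the comparison with \<open>t powr (- g)\<close> would fail.\<close>
    have "AE s in lborel. s \<noteq> (t::real)" by (rule AE_lborel_singleton)
    then show "AE s in lborel. t powr (- g) * (indicator {0..t} s * r s) \<le> indicator {0..t} s * ((t - s) powr (1 - g - 1) * r s)"
    proof eventually_elim
      case (elim s)
      show ?case
      proof (cases "s \<in> {0..t}")
        case True
        then have "t powr (- g) \<le> (t - s) powr (- g)" using elim g by (intro powr_mono2') auto
        then have "t powr (- g) * r s \<le> (t - s) powr (- g) * r s" using True rnn[of s] by (intro mult_right_mono) auto
        then show ?thesis using True by simp
      qed auto
    qed
  qed
  have up: "\<phi> t * (t powr g / g) \<le> Gamma g * (1 - \<phi> t)"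
  proof (rule has_bochner_integral_mono_AE)
    show "has_bochner_integral lborel (\<lambda>s. indicator {0..t} s * ((t - s) powr (g - 1) * \<phi> s)) (Gamma g * (1 - \<phi> t))"
      using ml_kernel_convolution[of g 1 g t] t g by (simp add: shift) (simp add: \<phi>_def)
    show "has_bochner_integral lborel (\<lambda>s. \<phi> t * (indicator {0..t} s * (t - s) powr (g - 1))) (\<phi> t * (t powr g / g))"
      using has_bochner_integral_mult_right[where c = "\<phi> t", OF powr_kernel_integral[OF g(1) t]] by simp
    \<comment> \<open>At s = 0 the kernel \<phi> has the default value 0, so \<open>anti\<close> is
      available for positive arguments only.\<close>
    have "AE s in lborel. s \<noteq> (0::real)" by (rule AE_lborel_singleton)
    then show "AE s in lborel. \<phi> t * (indicator {0..t} s * (t - s) powr (g - 1)) \<le> indicator {0..t} s * ((t - s) powr (g - 1) * \<phi> s)"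
    proof eventually_elim
      case (elim s)
      show ?case
      proof (cases "s \<in> {0..t}")
        case True
        then have "\<phi> t \<le> \<phi> s" using elim by (intro anti) auto
        then have "(t - s) powr (g - 1) * \<phi> t \<le> (t - s) powr (g - 1) * \<phi> s" by (intro mult_left_mono) auto
        then show ?thesis using True by (simp add: mult_ac)
      qed auto
    qed
  qed
  define y where "y = t powr g"
  have y: "0 < y" "t powr (- g) = 1 / y" using t by (auto simp: y_def powr_minus_divide)
  have G1: "0 < Gamma (1 - g)" using g by (simp add: Gamma_real_pos)
  have Gg: "0 < Gamma g" using g by (simp add: Gamma_real_pos)
  have Gp: "Gamma (1 + g) = g * Gamma g"
    by (rule Gamma_real_plus1[OF g(1)])
  have "1 - \<phi> t \<le> Gamma (1 - g) * y * \<phi> t"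
    using low y by (simp add: field_simps)
  then have "1 \<le> \<phi> t * (1 + Gamma (1 - g) * y)" by (simp add: algebra_simps)
  moreover have "0 < 1 + Gamma (1 - g) * y" using G1 y by (intro add_pos_pos mult_pos_pos) auto
  ultimately show "1 / (1 + Gamma (1 - g) * t powr g) \<le> \<phi> t"
    unfolding y_def[symmetric] by (simp add: pos_divide_le_eq)
  have "\<phi> t * (y / (g * Gamma g)) \<le> 1 - \<phi> t"
  proof -
    have "\<phi> t * (y / (g * Gamma g)) = (\<phi> t * (y / g)) / Gamma g" by simp
    also have "\<dots> \<le> (Gamma g * (1 - \<phi> t)) / Gamma g"
      using up Gg unfolding y_def[symmetric] by (intro divide_right_mono) auto
    finally show ?thesis using Gg by simp
  qed
  then have "\<phi> t * (1 + y / Gamma (1 + g)) \<le> 1" unfolding Gp distrib_left by linarith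
  moreover have "0 < 1 + y / Gamma (1 + g)" using Gg g y unfolding Gp by (intro add_pos_pos divide_pos_pos mult_pos_pos) auto
  ultimately show "\<phi> t \<le> 1 / (1 + t powr g / Gamma (1 + g))"
    unfolding y_def[symmetric] by (simp add: pos_le_divide_eq)
qed

text \<open>The substitution \<open>x = t powr g\<close> turns the kernel bounds into bounds for the
  function. The case x = 0 is separate because the kernel has its default value 0 there, whereas the
  function equals 1.\<close>

theorem mittag_leffler_bounds:
  assumes g: "0 < g" "g < 1" and x: "0 \<le> x"
  shows "1 / (1 + Gamma (1 - g) * x) \<le> mittag_leffler g 1 (- x)"
    "mittag_leffler g 1 (- x) \<le> 1 / (1 + x / Gamma (1 + g))"
proof -
  define t where "t = x powr (1 / g)"
  show "1 / (1 + Gamma (1 - g) * x) \<le> mittag_leffler g 1 (- x)"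
    using ml_kernel_1_bounds(1)[OF g, of t] x g mittag_leffler_0[of g 1]
    by (cases "x = 0") (auto simp: t_def powr_powr ml_kernel_def)
  show "mittag_leffler g 1 (- x) \<le> 1 / (1 + x / Gamma (1 + g))"
    using ml_kernel_1_bounds(2)[OF g, of t] x g mittag_leffler_0[of g 1]
    by (cases "x = 0") (auto simp: t_def powr_powr ml_kernel_def)
qed

subsection \<open>Gaussian regularisation of the Fourier integral\<close>

lemma integrable_times_bounded:
  fixes f g :: "'a \<Rightarrow> complex"
  assumes "integrable M f" "g \<in> borel_measurable M" "\<And>x. cmod (g x) \<le> 1"
  shows "integrable M (\<lambda>x. g x * f x)"
proof (rule Bochner_Integration.integrable_bound[OF assms(1)])
  show "AE x in M. norm (g x * f x) \<le> norm (f x)"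
    using assms(3) by (auto simp: norm_mult intro!: mult_left_le_one_le)
qed (use assms in auto)

lemma measurable_cis [measurable]: "cis \<in> borel_measurable borel"
  by (intro borel_measurable_continuous_onI continuous_intros)

text \<open>After rescaling by s this is the characteristic function of the standard normal
  distribution. Writing the result as 2 pi times a probability density prepares for a kernel of mass
  one.\<close>

lemma gaussian_fourier_real:
  fixes s u :: real
  assumes "0 < s"
  shows "has_bochner_integral lborel (\<lambda>x. cis (- (u * x)) * complex_of_real (exp (- (s * x)\<^sup>2 / 2)))
           (complex_of_real (2 * pi * normal_density 0 s u))"
proof -
  let ?f = "\<lambda>x. cis (- (u / s * x)) * complex_of_real (std_normal_density x)"
  have int: "integrable lborel ?f"
    by (intro integrable_times_bounded) auto
  have "integral\<^sup>L lborel ?f = (LINT x|lborel. std_normal_density x *\<^sub>R iexp ((- (u / s)) * x))"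
    by (intro Bochner_Integration.integral_cong) (auto simp: scaleR_conv_of_real cis_conv_exp mult_ac)
  also have "\<dots> = char std_normal_distribution (- (u / s))"
    unfolding char_def by (subst integral_density) auto
  also have "\<dots> = complex_of_real (exp (- ((u / s)\<^sup>2) / 2))"
    by (simp add: char_std_normal_distribution)
  finally have "has_bochner_integral lborel ?f (complex_of_real (exp (- ((u / s)\<^sup>2) / 2)))"
    using int by (simp add: has_bochner_integral_iff)
  then have "has_bochner_integral lborel (\<lambda>x. ?f (0 + s * x)) (complex_of_real (exp (- ((u / s)\<^sup>2) / 2)) /\<^sub>R \<bar>s\<bar>)"
    using lborel_has_bochner_integral_real_affine_iff[of s ?f _ 0] assms by blast
  from has_bochner_integral_mult_right[where c = "complex_of_real (sqrt (2 * pi))", OF this]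
  have "has_bochner_integral lborel (\<lambda>x. complex_of_real (sqrt (2 * pi)) * ?f (0 + s * x))
    (complex_of_real (sqrt (2 * pi)) * (complex_of_real (exp (- ((u / s)\<^sup>2) / 2)) /\<^sub>R \<bar>s\<bar>))" .
  moreover have "complex_of_real (sqrt (2 * pi)) * ?f (0 + s * x) = cis (- (u * x)) * complex_of_real (exp (- (s * x)\<^sup>2 / 2))" for x
    using assms by (simp add: std_normal_density_def)
  moreover have "complex_of_real (sqrt (2 * pi)) * (complex_of_real (exp (- ((u / s)\<^sup>2) / 2)) /\<^sub>R \<bar>s\<bar>) =
     complex_of_real (2 * pi * normal_density 0 s u)"
  proof -
    have "sqrt (2 * pi) * (exp (- ((u / s)\<^sup>2) / 2) / s) = 2 * pi * normal_density 0 s u"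
    proof -
      define q where "q = sqrt (2 * pi)"
      have q: "2 * pi = q * q" "0 < q" by (simp_all add: q_def)
      have "sqrt (2 * pi * s\<^sup>2) = q * s" using assms by (simp add: q_def real_sqrt_mult)
      then have "2 * pi * normal_density 0 s u = q * q * (1 / (q * s) * exp (-u\<^sup>2/ (2 * s\<^sup>2)))"
        unfolding normal_density_def q(1)[symmetric] by simp
      then show ?thesis unfolding q_def[symmetric] using assms q(2) by (simp add: power_divide mult.commute)
    qed
    moreover have "complex_of_real q * (complex_of_real a /\<^sub>R \<bar>s\<bar>) = complex_of_real (q * (a / s))" for q a
      using assms by (simp add: scaleR_conv_of_real divide_inverse mult.commute)
    ultimately show ?thesis by (simp only:)
  qed
  ultimately show ?thesis by (simp only:)
qed

text \<open>Lebesgue measure is the image of the product measure over \<open>Basis\<close> under the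
  coordinate map, so Fubini for finite products applies.\<close>

lemma has_bochner_integral_lborel_prod:
  fixes f :: "'a::euclidean_space \<Rightarrow> real \<Rightarrow> complex"
  assumes "\<And>b. b \<in> Basis \<Longrightarrow> has_bochner_integral lborel (f b) (c b)"
  shows "has_bochner_integral lborel (\<lambda>x. \<Prod>b\<in>Basis. f b (x \<bullet> b)) (\<Prod>b\<in>Basis. c b)"
proof -
  interpret product_sigma_finite "\<lambda>_::'a. lborel :: real measure" ..
  have int: "\<And>b. b \<in> Basis \<Longrightarrow> integrable lborel (f b)" and eq: "\<And>b. b \<in> Basis \<Longrightarrow> integral\<^sup>L lborel (f b) = c b"
    using assms by (auto simp: has_bochner_integral_iff)
  have [measurable]: "\<And>b. b \<in> Basis \<Longrightarrow> f b \<in> borel_measurable borel" using int by auto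
  have m: "(\<lambda>x. \<Prod>b\<in>Basis. f b (x \<bullet> b)) \<in> borel_measurable (borel :: 'a measure)" by measurable
  have T: "(\<lambda>g. \<Sum>b\<in>Basis. g b *\<^sub>R b) \<in> measurable (\<Pi>\<^sub>M b\<in>(Basis::'a set). (lborel :: real measure)) (borel :: 'a measure)"
    by measurable
  have pt: "(\<Prod>b\<in>Basis. f b ((\<Sum>b\<in>Basis. g b *\<^sub>R b) \<bullet> b)) = (\<Prod>b\<in>Basis. f b (g b))" for g :: "'a \<Rightarrow> real"
    by (intro prod.cong) auto
  have "integrable (\<Pi>\<^sub>M b\<in>(Basis::'a set). (lborel :: real measure)) (\<lambda>g. \<Prod>b\<in>Basis. f b (g b))"
    by (intro product_integrable_prod int) auto
  then have 1: "integrable lborel (\<lambda>x::'a. \<Prod>b\<in>Basis. f b (x \<bullet> b))"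
    by (subst lborel_eq) (simp only: integrable_distr_eq[OF T m] pt)
  have "integral\<^sup>L lborel (\<lambda>x::'a. \<Prod>b\<in>Basis. f b (x \<bullet> b)) = (\<Prod>b\<in>Basis. integral\<^sup>L lborel (f b))"
    by (subst lborel_eq) (simp only: integral_distr[OF T m] pt product_integral_prod[OF finite_Basis int])
  with 1 eq show ?thesis by (simp add: has_bochner_integral_iff)
qed

text \<open>This is exp (- s^2 |\<xi>|^2 / 2), kept as a product over coordinates so that the
  one-dimensional integrals apply to each factor. It tends to 1 as s tends to 0.\<close>

definition gauss_weight :: "real \<Rightarrow> 'a::euclidean_space \<Rightarrow> real" where
  "gauss_weight s \<xi> = (\<Prod>b\<in>Basis. exp (- (s * (\<xi> \<bullet> b))\<^sup>2 / 2))"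

definition gauss_kernel :: "real \<Rightarrow> 'a::euclidean_space \<Rightarrow> real" where
  "gauss_kernel s x = (\<Prod>b\<in>Basis. normal_density 0 s (x \<bullet> b))"

lemma gauss_measurable [measurable]:
  "gauss_weight s \<in> borel_measurable borel" "gauss_kernel s \<in> borel_measurable borel"
  unfolding gauss_weight_def[abs_def] gauss_kernel_def[abs_def] by measurable

lemma gauss_nonneg [simp]: "0 \<le> gauss_weight s x" "0 \<le> gauss_kernel s x"
  by (auto simp: gauss_weight_def gauss_kernel_def intro!: prod_nonneg)

lemma gauss_kernel_minus: "gauss_kernel s (- x) = gauss_kernel s x"
  by (simp add: gauss_kernel_def normal_density_def)

lemma nn_integral_gauss_kernel:
  assumes "0 < s"
  shows "(\<integral>\<^sup>+x. ennreal (gauss_kernel s (x::'a::euclidean_space)) \<partial>lborel) = 1"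
proof -
  have 1: "(\<integral>\<^sup>+x. ennreal (normal_density 0 s x) \<partial>lborel) = 1"
    using assms by (subst nn_integral_eq_integral) auto
  have "(\<integral>\<^sup>+x. ennreal (gauss_kernel s (x::'a)) \<partial>lborel) = (\<integral>\<^sup>+x. (\<Prod>b\<in>Basis. ennreal (normal_density 0 s ((x::'a) \<bullet> b))) \<partial>lborel)"
    by (intro nn_integral_cong) (simp add: gauss_kernel_def prod_ennreal)
  also have "\<dots> = 1"
    by (subst nn_integral_lborel_prod) (use 1 in auto)
  finally show ?thesis .
qed

lemma nn_integral_lborel_translate:
  fixes f :: "'a::euclidean_space \<Rightarrow> ennreal"
  assumes [measurable]: "f \<in> borel_measurable borel"
  shows "(\<integral>\<^sup>+x. f (c + x) \<partial>lborel) = (\<integral>\<^sup>+x. f x \<partial>lborel)"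
proof -
  have "(lborel :: 'a measure) = distr lborel borel (\<lambda>x. c + x)"
    using lborel_affine[of 1 c] by (simp add: density_1)
  then have "(\<integral>\<^sup>+x. f x \<partial>lborel) = (\<integral>\<^sup>+x. f x \<partial>distr lborel borel (\<lambda>x. c + x))" by simp
  then show ?thesis by (simp add: nn_integral_distr)
qed

lemma nn_integral_gauss_kernel_diff:
  fixes c :: "'a::euclidean_space"
  assumes "0 < s"
  shows "(\<integral>\<^sup>+x. ennreal (gauss_kernel s (x - c)) \<partial>lborel) = 1"
    and "(\<integral>\<^sup>+x. ennreal (gauss_kernel s (c - x)) \<partial>lborel) = 1"
proof -
  show 1: "(\<integral>\<^sup>+x. ennreal (gauss_kernel s (x - c)) \<partial>lborel) = 1"
    using nn_integral_lborel_translate[of "\<lambda>x. ennreal (gauss_kernel s x)" "- c"]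
      nn_integral_gauss_kernel[OF assms, where 'a='a] by simp
  show "(\<integral>\<^sup>+x. ennreal (gauss_kernel s (c - x)) \<partial>lborel) = 1"
    using 1 gauss_kernel_minus[of s "x - c" for x] by simp
qed

lemma gaussian_fourier:
  fixes x :: "'a::euclidean_space"
  assumes "0 < s"
  shows "has_bochner_integral lborel (\<lambda>\<xi>. cis (- (x \<bullet> \<xi>)) * complex_of_real (gauss_weight s \<xi>))
           (complex_of_real ((2 * pi) ^ DIM('a) * gauss_kernel s x))"
proof -
  have "has_bochner_integral lborel
    (\<lambda>\<xi>. \<Prod>b\<in>Basis. cis (- ((x \<bullet> b) * (\<xi> \<bullet> b))) * complex_of_real (exp (- (s * (\<xi> \<bullet> b))\<^sup>2 / 2)))
    (\<Prod>b\<in>Basis. complex_of_real (2 * pi * normal_density 0 s (x \<bullet> b)))"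
    by (rule has_bochner_integral_lborel_prod[where f = "\<lambda>b \<xi>. cis (- ((x \<bullet> b) * \<xi>)) * complex_of_real (exp (- (s * \<xi>)\<^sup>2 / 2))"])
      (rule gaussian_fourier_real[OF assms])
  moreover have "(\<Prod>b\<in>Basis. complex_of_real (2 * pi * normal_density 0 s (x \<bullet> b))) =
     complex_of_real ((2 * pi) ^ DIM('a) * gauss_kernel s x)"
    by (simp add: gauss_kernel_def prod.distrib)
  moreover have "(\<Prod>b\<in>Basis. cis (- ((x \<bullet> b) * (\<xi> \<bullet> b))) * complex_of_real (exp (- (s * (\<xi> \<bullet> b))\<^sup>2 / 2))) =
     cis (- (x \<bullet> \<xi>)) * complex_of_real (gauss_weight s \<xi>)" for \<xi>
  proof -
    have "cis (- (x \<bullet> \<xi>)) = (\<Prod>b\<in>Basis. cis (- ((x \<bullet> b) * (\<xi> \<bullet> b))))"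
      by (subst euclidean_inner) (simp add: cis_conv_exp exp_sum[symmetric] sum_negf sum_distrib_left)
    then show ?thesis by (simp add: gauss_weight_def prod.distrib)
  qed
  ultimately show ?thesis by (simp only:)
qed

text \<open>Justifies both uses of Fubini below: h is the oscillating factor, and its bound by 1
  leaves a product of two integrable functions as majorant.\<close>

lemma integrable_prod_lborel:
  fixes f g :: "'a::euclidean_space \<Rightarrow> complex"
  assumes f: "integrable lborel f" and g: "integrable lborel g"
    and h [measurable]: "h \<in> borel_measurable (borel \<Otimes>\<^sub>M borel)" and h1: "\<And>z. cmod (h z) \<le> 1"
  shows "integrable (lborel \<Otimes>\<^sub>M lborel) (\<lambda>(x, y). h (x, y) * (f x * g y))"
proof (rule lborel_pair.Fubini_integrable)
  have [measurable]: "f \<in> borel_measurable borel" "g \<in> borel_measurable borel" using f g by auto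
  show "(\<lambda>(x, y). h (x, y) * (f x * g y)) \<in> borel_measurable (lborel \<Otimes>\<^sub>M lborel)" by measurable
  have le: "cmod (h (x, y) * (f x * g y)) \<le> cmod (f x) * cmod (g y)" for x y
    using mult_right_mono[OF h1[of "(x,y)"], of "cmod (f x) * cmod (g y)"] by (simp add: norm_mult)
  have I: "integrable lborel (\<lambda>y. h (x, y) * (f x * g y))" for x
  proof (rule Bochner_Integration.integrable_bound)
    show "integrable lborel (\<lambda>y. f x * g y)" using g by simp
    show "AE y in lborel. cmod (h (x, y) * (f x * g y)) \<le> cmod (f x * g y)"
      using le[of x] by (auto simp: norm_mult)
  qed measurable
  show "AE x in lborel. integrable lborel (\<lambda>y. case (x, y) of (x, y) \<Rightarrow> h (x, y) * (f x * g y))"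
    using I by simp
  show "integrable lborel (\<lambda>x. LINT y|lborel. cmod (case (x, y) of (x, y) \<Rightarrow> h (x, y) * (f x * g y)))"
  proof (rule Bochner_Integration.integrable_bound)
    show "integrable lborel (\<lambda>x. f x * (LINT y|lborel. cmod (g y)))" using f by simp
    show "AE x in lborel. norm (LINT y|lborel. cmod (case (x, y) of (x, y) \<Rightarrow> h (x, y) * (f x * g y)))
       \<le> norm (f x * (LINT y|lborel. cmod (g y)))"
    proof (rule AE_I2)
      fix x
      have "(LINT y|lborel. cmod (h (x, y) * (f x * g y))) \<le> (LINT y|lborel. cmod (f x) * cmod (g y))"
        using I g le by (intro integral_mono integrable_norm) auto
      then show "norm (LINT y|lborel. cmod (case (x, y) of (x, y) \<Rightarrow> h (x, y) * (f x * g y)))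
       \<le> norm (f x * (LINT y|lborel. cmod (g y)))"
        by (simp add: norm_mult integral_nonneg_AE)
    qed
  qed measurable
qed

subsection \<open>Bessel's inequality and completeness\<close>

text \<open>For a non-integrable f the Bochner integral takes the default value 0, which makes the
  bound trivial.\<close>

lemma norm_integral_le_nn_integral:
  fixes f :: "'a \<Rightarrow> complex"
  shows "ennreal (cmod (integral\<^sup>L M f)) \<le> (\<integral>\<^sup>+x. ennreal (cmod (f x)) \<partial>M)"
  by (cases "integrable M f") (auto intro: integral_norm_bound_ennreal simp: not_integrable_integral_eq)

lemma measurable_cnj [measurable]: "cnj \<in> borel_measurable borel"
  by (intro borel_measurable_continuous_onI continuous_intros)

definition osc_integral :: "('a::euclidean_space \<Rightarrow> complex) \<Rightarrow> 'a \<Rightarrow> complex" where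
  "osc_integral f \<xi> = (LINT x|lborel. cis (- (x \<bullet> \<xi>)) * f x)"

lemma osc_integral_measurable [measurable]:
  assumes [measurable]: "f \<in> borel_measurable borel"
  shows "osc_integral f \<in> borel_measurable borel"
  unfolding osc_integral_def[abs_def] by measurable

lemma osc_integral_bound:
  assumes "integrable lborel f"
  shows "cmod (osc_integral f \<xi>) \<le> (LINT x|lborel. cmod (f x))"
proof -
  have "cmod (osc_integral f \<xi>) \<le> (LINT x|lborel. cmod (cis (- (x \<bullet> \<xi>)) * f x))"
    unfolding osc_integral_def by simp
  then show ?thesis by (simp add: norm_mult)
qed

text \<open>
  After Fubini the weighted integral becomes the double integral of \<open>f x\<close>, the conjugate of \<open>f y\<close>
  and an approximate identity in \<open>x - y\<close>; AM-GM on \<open>|f x| |f y|\<close> then avoids Plancherel's identity.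
\<close>

lemma gauss_weighted_bessel:
  fixes f :: "'a::euclidean_space \<Rightarrow> complex"
  assumes f: "integrable lborel f" and s: "0 < s"
  shows "(\<integral>\<^sup>+\<xi>. ennreal (gauss_weight s \<xi> * (cmod (osc_integral f \<xi>))\<^sup>2) \<partial>lborel)
    \<le> ennreal ((2 * pi) ^ DIM('a)) * (\<integral>\<^sup>+x. ennreal ((cmod (f x))\<^sup>2) \<partial>lborel)"
proof -
  define Z where "Z = osc_integral f"
  define c where "c = (2 * pi) ^ DIM('a)"
  have c: "0 \<le> c" by (simp add: c_def)
  have fm [measurable]: "f \<in> borel_measurable borel" using f by auto
  have Zm [measurable]: "Z \<in> borel_measurable borel" by (simp add: Z_def)
  define W where "W \<xi> = complex_of_real (gauss_weight s (\<xi>::'a))" for \<xi>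
  have Wm [measurable]: "W \<in> borel_measurable borel" unfolding W_def by measurable
  have Wi: "integrable lborel W"
    using gaussian_fourier[OF s, of "0::'a"] by (simp add: has_bochner_integral_iff W_def[abs_def])
  define K where "K = (LINT x|lborel. cmod (f x))"
  have ZK: "cmod (Z \<xi>) \<le> K" for \<xi> unfolding Z_def K_def by (rule osc_integral_bound[OF f])
  \<comment> \<open>This is the purpose of the Gaussian weight: Z is known to be bounded, and
    damping makes the frequency integrals absolutely convergent, as Fubini demands.\<close>
  have bdd: "integrable lborel (\<lambda>\<xi>. W \<xi> * g \<xi>)" if [measurable]: "g \<in> borel_measurable borel" and "\<And>\<xi>. cmod (g \<xi>) \<le> B" for g B
  proof (rule Bochner_Integration.integrable_bound)
    show "integrable lborel (\<lambda>\<xi>. W \<xi> * complex_of_real B)" using Wi by simp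
    have "cmod (g \<xi>) \<le> \<bar>B\<bar>" for \<xi> using that(2)[of \<xi>] by linarith
    then show "AE x in lborel. norm (W x * g x) \<le> norm (W x * complex_of_real B)"
      by (auto simp: norm_mult intro!: mult_left_mono)
  qed measurable
  have WZ: "integrable lborel (\<lambda>\<xi>. W \<xi> * cnj (Z \<xi>))" by (rule bdd[of _ K]) (use ZK in auto)
  have WZZ: "integrable lborel (\<lambda>\<xi>. W \<xi> * (Z \<xi> * cnj (Z \<xi>)))"
    by (rule bdd[of _ "K * K"]) (auto simp: norm_mult intro!: mult_mono ZK order_trans[OF norm_ge_zero ZK])
  have cn: "integrable lborel (\<lambda>x. cnj (f x))" using f by simp
  have eqr: "W \<xi> * (Z \<xi> * cnj (Z \<xi>)) = complex_of_real (gauss_weight s \<xi> * (cmod (Z \<xi>))\<^sup>2)" for \<xi>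
    unfolding W_def of_real_mult complex_norm_square ..
  define I where "I = (LINT \<xi>|lborel. W \<xi> * (Z \<xi> * cnj (Z \<xi>)))"
  have rI: "integrable lborel (\<lambda>\<xi>. gauss_weight s \<xi> * (cmod (Z \<xi>))\<^sup>2)"
    using WZZ integrable_Re[OF WZZ] by (simp only: eqr Re_complex_of_real)
  have "I = complex_of_real (LINT \<xi>|lborel. gauss_weight s \<xi> * (cmod (Z \<xi>))\<^sup>2)"
    unfolding I_def eqr by (rule integral_complex_of_real)
  then have start: "(\<integral>\<^sup>+\<xi>. ennreal (gauss_weight s \<xi> * (cmod (Z \<xi>))\<^sup>2) \<partial>lborel) = ennreal (cmod I)"
    using rI by (subst nn_integral_eq_integral) (auto simp: integral_nonneg_AE)
  define B where "B x = (LINT \<xi>|lborel. cis (- (x \<bullet> \<xi>)) * (W \<xi> * cnj (Z \<xi>)))" for x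
  have "I = (LINT \<xi>|lborel. (LINT x|lborel. cis (- (x \<bullet> \<xi>)) * (f x * (W \<xi> * cnj (Z \<xi>)))))"
  proof -
    have "W \<xi> * (Z \<xi> * cnj (Z \<xi>)) = (LINT x|lborel. cis (- (x \<bullet> \<xi>)) * (f x * (W \<xi> * cnj (Z \<xi>))))" for \<xi>
    proof -
      have "(LINT x|lborel. cis (- (x \<bullet> \<xi>)) * (f x * (W \<xi> * cnj (Z \<xi>)))) = (LINT x|lborel. (cis (- (x \<bullet> \<xi>)) * f x) * (W \<xi> * cnj (Z \<xi>)))"
        by (simp only: mult.assoc)
      also have "\<dots> = Z \<xi> * (W \<xi> * cnj (Z \<xi>))"
        unfolding Z_def osc_integral_def by (rule integral_mult_left_zero)
      finally show ?thesis by (simp only: mult_ac)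
    qed
    then show ?thesis unfolding I_def by simp
  qed
  also have "\<dots> = (LINT x|lborel. (LINT \<xi>|lborel. cis (- (x \<bullet> \<xi>)) * (f x * (W \<xi> * cnj (Z \<xi>)))))"
    by (rule lborel_pair.Fubini_integral)
      (use integrable_prod_lborel[OF f WZ, of "\<lambda>(x, \<xi>). cis (- (x \<bullet> \<xi>))"] in auto)
  also have "\<dots> = (LINT x|lborel. f x * B x)"
  proof (intro Bochner_Integration.integral_cong refl)
    fix x
    have "(LINT \<xi>|lborel. cis (- (x \<bullet> \<xi>)) * (f x * (W \<xi> * cnj (Z \<xi>)))) = (LINT \<xi>|lborel. f x * (cis (- (x \<bullet> \<xi>)) * (W \<xi> * cnj (Z \<xi>))))"
      by (simp only: mult_ac)
    then show "(LINT \<xi>|lborel. cis (- (x \<bullet> \<xi>)) * (f x * (W \<xi> * cnj (Z \<xi>)))) = f x * B x"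
      by (simp add: B_def)
  qed
  finally have I: "I = (LINT x|lborel. f x * B x)" .
  \<comment> \<open>Unfolding the conjugate factor and integrating over \<xi> first turns the
    oscillation at x - y into the Gaussian kernel.\<close>
  have Bx: "B x = (LINT y|lborel. cnj (f y) * complex_of_real (c * gauss_kernel s (x - y)))" for x
  proof -
    have "B x = (LINT \<xi>|lborel. (LINT y|lborel. cis (- ((x - y) \<bullet> \<xi>)) * (cnj (f y) * W \<xi>)))"
      unfolding B_def
    proof (intro Bochner_Integration.integral_cong refl)
      fix \<xi>
      have "cnj (Z \<xi>) = (LINT y|lborel. cnj (cis (- (y \<bullet> \<xi>)) * f y))"
        unfolding Z_def osc_integral_def by (rule Bochner_Integration.integral_cnj[symmetric])
      then have "cis (- (x \<bullet> \<xi>)) * (W \<xi> * cnj (Z \<xi>)) =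
          (cis (- (x \<bullet> \<xi>)) * W \<xi>) * (LINT y|lborel. cnj (cis (- (y \<bullet> \<xi>)) * f y))" by simp
      also have "\<dots> = (LINT y|lborel. (cis (- (x \<bullet> \<xi>)) * W \<xi>) * cnj (cis (- (y \<bullet> \<xi>)) * f y))"
        by (rule integral_mult_right_zero[symmetric])
      also have "\<dots> = (LINT y|lborel. cis (- ((x - y) \<bullet> \<xi>)) * (cnj (f y) * W \<xi>))"
      proof (intro Bochner_Integration.integral_cong refl)
        fix y
        have "cis (- ((x - y) \<bullet> \<xi>)) = cis (- (x \<bullet> \<xi>)) * cnj (cis (- (y \<bullet> \<xi>)))"
          by (simp add: cis_cnj cis_mult inner_diff_left)
        then show "(cis (- (x \<bullet> \<xi>)) * W \<xi>) * cnj (cis (- (y \<bullet> \<xi>)) * f y) = cis (- ((x - y) \<bullet> \<xi>)) * (cnj (f y) * W \<xi>)"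
          by (simp add: mult_ac)
      qed
      finally show "cis (- (x \<bullet> \<xi>)) * (W \<xi> * cnj (Z \<xi>)) = (LINT y|lborel. cis (- ((x - y) \<bullet> \<xi>)) * (cnj (f y) * W \<xi>))" .
    qed
    also have "\<dots> = (LINT y|lborel. (LINT \<xi>|lborel. cis (- ((x - y) \<bullet> \<xi>)) * (cnj (f y) * W \<xi>)))"
      by (rule lborel_pair.Fubini_integral)
        (use integrable_prod_lborel[OF cn Wi, of "\<lambda>(y, \<xi>). cis (- ((x - y) \<bullet> \<xi>))"] in auto)
    also have "\<dots> = (LINT y|lborel. cnj (f y) * complex_of_real (c * gauss_kernel s (x - y)))"
    proof (intro Bochner_Integration.integral_cong refl)
      fix y
      have "(LINT \<xi>|lborel. cis (- ((x - y) \<bullet> \<xi>)) * (cnj (f y) * W \<xi>)) = (LINT \<xi>|lborel. cnj (f y) * (cis (- ((x - y) \<bullet> \<xi>)) * W \<xi>))"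
        by (simp only: mult_ac)
      also have "\<dots> = cnj (f y) * complex_of_real (c * gauss_kernel s (x - y))"
        using gaussian_fourier[OF s, of "x - y"] by (simp add: has_bochner_integral_iff W_def c_def)
      finally show "(LINT \<xi>|lborel. cis (- ((x - y) \<bullet> \<xi>)) * (cnj (f y) * W \<xi>)) = cnj (f y) * complex_of_real (c * gauss_kernel s (x - y))" .
    qed
    finally show ?thesis .
  qed
  let ?N = "\<lambda>x y. ennreal (gauss_kernel s (x - y))"
  let ?q = "\<lambda>x. ennreal ((cmod (f x))\<^sup>2)"
  have "ennreal (cmod I) \<le> (\<integral>\<^sup>+x. ennreal (cmod (f x * B x)) \<partial>lborel)"
    unfolding I by (rule norm_integral_le_nn_integral)
  also have "\<dots> \<le> (\<integral>\<^sup>+x. (\<integral>\<^sup>+y. ennreal (c / 2) * (?N x y * ?q x + ?N x y * ?q y) \<partial>lborel) \<partial>lborel)"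
  proof (rule nn_integral_mono)
    fix x
    have "ennreal (cmod (f x * B x)) = ennreal (cmod (LINT y|lborel. f x * (cnj (f y) * complex_of_real (c * gauss_kernel s (x - y)))))"
      by (simp only: Bx integral_mult_right_zero)
    also have "\<dots> \<le> (\<integral>\<^sup>+y. ennreal (cmod (f x * (cnj (f y) * complex_of_real (c * gauss_kernel s (x - y))))) \<partial>lborel)"
      by (rule norm_integral_le_nn_integral)
    also have "\<dots> \<le> (\<integral>\<^sup>+y. ennreal (c / 2) * (?N x y * ?q x + ?N x y * ?q y) \<partial>lborel)"
    proof (rule nn_integral_mono)
      fix y
      have "cmod (f x) * cmod (f y) \<le> ((cmod (f x))\<^sup>2 + (cmod (f y))\<^sup>2) / 2"
        using sum_squares_bound[of "cmod (f x)" "cmod (f y)"] by simp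
      then have "(cmod (f x) * cmod (f y)) * (c * gauss_kernel s (x - y)) \<le> (((cmod (f x))\<^sup>2 + (cmod (f y))\<^sup>2) / 2) * (c * gauss_kernel s (x - y))"
        using c by (intro mult_right_mono) auto
      then have "cmod (f x * (cnj (f y) * complex_of_real (c * gauss_kernel s (x - y)))) \<le>
         c / 2 * (gauss_kernel s (x - y) * (cmod (f x))\<^sup>2 + gauss_kernel s (x - y) * (cmod (f y))\<^sup>2)"
        using c by (simp add: norm_mult abs_mult algebra_simps add_divide_distrib)
      then have "ennreal (cmod (f x * (cnj (f y) * complex_of_real (c * gauss_kernel s (x - y))))) \<le>
         ennreal (c / 2 * (gauss_kernel s (x - y) * (cmod (f x))\<^sup>2 + gauss_kernel s (x - y) * (cmod (f y))\<^sup>2))"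
        by (rule ennreal_leI)
      also have "\<dots> = ennreal (c / 2) * (?N x y * ?q x + ?N x y * ?q y)"
      proof -
        have ee: "ennreal (e * (u * a + u * b)) = ennreal e * (ennreal u * ennreal a + ennreal u * ennreal b)"
          if "0 \<le> e" "0 \<le> u" "0 \<le> a" "0 \<le> b" for e u a b
          using that by (simp add: ennreal_mult ennreal_plus)
        show ?thesis by (rule ee) (use c in auto)
      qed
      finally show "ennreal (cmod (f x * (cnj (f y) * complex_of_real (c * gauss_kernel s (x - y))))) \<le> ennreal (c / 2) * (?N x y * ?q x + ?N x y * ?q y)" .
    qed
    finally show "ennreal (cmod (f x * B x)) \<le> (\<integral>\<^sup>+y. ennreal (c / 2) * (?N x y * ?q x + ?N x y * ?q y) \<partial>lborel)" .
  qed
  also have "\<dots> = ennreal (c / 2) * ((\<integral>\<^sup>+x. (\<integral>\<^sup>+y. ?N x y * ?q x \<partial>lborel) \<partial>lborel) + (\<integral>\<^sup>+x. (\<integral>\<^sup>+y. ?N x y * ?q y \<partial>lborel) \<partial>lborel))"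
    by (simp add: nn_integral_cmult nn_integral_add)
  also have "(\<integral>\<^sup>+x. (\<integral>\<^sup>+y. ?N x y * ?q x \<partial>lborel) \<partial>lborel) = (\<integral>\<^sup>+x. ?q x \<partial>lborel)"
    by (simp add: nn_integral_multc nn_integral_gauss_kernel_diff[OF s])
  \<comment> \<open>The kernel has mass one in either variable, so after this exchange the second
    half of AM-GM also reduces to the square integral of f.\<close>
  also have "(\<integral>\<^sup>+x. (\<integral>\<^sup>+y. ?N x y * ?q y \<partial>lborel) \<partial>lborel) = (\<integral>\<^sup>+y. (\<integral>\<^sup>+x. ?N x y * ?q y \<partial>lborel) \<partial>lborel)"
    by (rule lborel_pair.Fubini'[symmetric]) measurable
  also have "\<dots> = (\<integral>\<^sup>+x. ?q x \<partial>lborel)"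
    by (simp add: nn_integral_multc nn_integral_gauss_kernel_diff[OF s])
  also have "ennreal (c / 2) * ((\<integral>\<^sup>+x. ?q x \<partial>lborel) + (\<integral>\<^sup>+x. ?q x \<partial>lborel)) = ennreal c * (\<integral>\<^sup>+x. ?q x \<partial>lborel)"
  proof -
    have "ennreal c = ennreal (c / 2) + ennreal (c / 2)" using c by (simp flip: ennreal_plus)
    then show ?thesis by (simp add: distrib_left distrib_right)
  qed
  finally show ?thesis unfolding start[unfolded Z_def] c_def .
qed

text \<open>The weighted bound has a right-hand side free of s, and the weights tend to 1, so
  Fatou's lemma removes them.\<close>

lemma osc_integral_bessel:
  fixes f :: "'a::euclidean_space \<Rightarrow> complex"
  assumes f: "integrable lborel f"
  shows "(\<integral>\<^sup>+\<xi>. ennreal ((cmod (osc_integral f \<xi>))\<^sup>2) \<partial>lborel)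
    \<le> ennreal ((2 * pi) ^ DIM('a)) * (\<integral>\<^sup>+x. ennreal ((cmod (f x))\<^sup>2) \<partial>lborel)"
proof -
  define s where "s k = 1 / real (Suc k)" for k
  have s: "s \<longlonglongrightarrow> 0" unfolding s_def by (rule LIMSEQ_Suc[OF lim_1_over_n])
  have [measurable]: "f \<in> borel_measurable borel" using f by auto
  have lim: "(\<lambda>k. ennreal (gauss_weight (s k) \<xi> * (cmod (osc_integral f \<xi>))\<^sup>2)) \<longlonglongrightarrow> ennreal ((cmod (osc_integral f \<xi>))\<^sup>2)" for \<xi>
  proof -
    have "(\<lambda>k. gauss_weight (s k) \<xi> * (cmod (osc_integral f \<xi>))\<^sup>2) \<longlonglongrightarrow> (\<Prod>b\<in>(Basis::'a set). exp (- (0 * (\<xi> \<bullet> b))\<^sup>2 / 2)) * (cmod (osc_integral f \<xi>))\<^sup>2"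
      unfolding gauss_weight_def by (intro tendsto_intros s) auto
    then show ?thesis by (intro tendsto_ennrealI) simp
  qed
  have "(\<integral>\<^sup>+\<xi>. ennreal ((cmod (osc_integral f \<xi>))\<^sup>2) \<partial>lborel) =
     (\<integral>\<^sup>+\<xi>. liminf (\<lambda>k. ennreal (gauss_weight (s k) \<xi> * (cmod (osc_integral f \<xi>))\<^sup>2)) \<partial>lborel)"
    using lim_imp_Liminf[OF _ lim] by (intro nn_integral_cong) simp
  also have "\<dots> \<le> liminf (\<lambda>k. \<integral>\<^sup>+\<xi>. ennreal (gauss_weight (s k) \<xi> * (cmod (osc_integral f \<xi>))\<^sup>2) \<partial>lborel)"
    by (rule nn_integral_liminf) measurable
  also have "\<dots> \<le> ennreal ((2 * pi) ^ DIM('a)) * (\<integral>\<^sup>+x. ennreal ((cmod (f x))\<^sup>2) \<partial>lborel)"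
    by (intro Liminf_le always_eventually allI gauss_weighted_bessel f) (auto simp: s_def)
  finally show ?thesis .
qed

text \<open>The rate 4^-k beats the weights 2^k, so the weighted sum of squared increments has
  finite integral and is finite almost everywhere; at such points the increments are
  summable.\<close>

lemma L2_Cauchy_sequence_converges:
  fixes F :: "nat \<Rightarrow> 'a \<Rightarrow> complex"
  assumes [measurable]: "\<And>k. F k \<in> borel_measurable M"
    and F: "\<And>k. (\<integral>\<^sup>+x. ennreal ((cmod (F (Suc k) x - F k x))\<^sup>2) \<partial>M) \<le> ennreal ((1 / 4) ^ k)"
  shows "\<exists>G \<in> borel_measurable M. AE x in M. (\<lambda>k. F k x) \<longlonglongrightarrow> G x"
proof (intro bexI)
  define d where "d k x = cmod (F (Suc k) x - F k x)" for k x
  have [measurable]: "d k \<in> borel_measurable M" for k unfolding d_def by measurable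
  have "(\<integral>\<^sup>+x. (\<Sum>k. ennreal (2 ^ k * (d k x)\<^sup>2)) \<partial>M) = (\<Sum>k. \<integral>\<^sup>+x. ennreal (2 ^ k * (d k x)\<^sup>2) \<partial>M)"
    by (rule nn_integral_suminf) measurable
  also have "\<dots> \<le> (\<Sum>k. ennreal ((1 / 2) ^ k))"
  proof (intro suminf_le summableI)
    fix k
    have "(\<integral>\<^sup>+x. ennreal (2 ^ k * (d k x)\<^sup>2) \<partial>M) = ennreal (2 ^ k) * (\<integral>\<^sup>+x. ennreal ((d k x)\<^sup>2) \<partial>M)"
      by (simp add: ennreal_mult nn_integral_cmult)
    also have "\<dots> \<le> ennreal (2 ^ k) * ennreal ((1 / 4) ^ k)"
      unfolding d_def by (intro mult_left_mono F) auto
    also have "\<dots> = ennreal ((1 / 2) ^ k)"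
      by (simp add: power_mult_distrib[symmetric] flip: ennreal_mult)
    finally show "(\<integral>\<^sup>+x. ennreal (2 ^ k * (d k x)\<^sup>2) \<partial>M) \<le> ennreal ((1 / 2) ^ k)" .
  qed
  also have "\<dots> < \<infinity>"
    by (subst suminf_ennreal2) (auto simp: summable_geometric)
  finally have "AE x in M. (\<Sum>k. ennreal (2 ^ k * (d k x)\<^sup>2)) \<noteq> \<infinity>"
    by (intro nn_integral_PInf_AE) auto
  then show "AE x in M. (\<lambda>k. F k x) \<longlonglongrightarrow> lim (\<lambda>k. F k x)"
  proof eventually_elim
    case (elim x)
    have s1: "summable (\<lambda>k. 2 ^ k * (d k x)\<^sup>2)"
      by (rule summable_suminf_not_top) (use elim in auto)
    have "summable (\<lambda>k. d k x)"
    proof (rule summable_comparison_test')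
      show "summable (\<lambda>k. 2 ^ k * (d k x)\<^sup>2 + (1 / 2) ^ k)"
        by (intro summable_add s1) (simp add: summable_geometric)
      fix k :: nat
      \<comment> \<open>AM-GM turns summability of \<open>2\<^sup>k d\<^sub>k\<^sup>2\<close> into summability of \<open>d\<^sub>k\<close>\<close>
      define t where "t = (2::real) ^ k"
      have t: "0 < t" "(1 / 2) ^ k = 1 / t" by (simp_all add: t_def power_one_over)
      have "0 \<le> (t * d k x - 1)\<^sup>2" by simp
      then have "2 * (t * d k x) \<le> t * (t * (d k x)\<^sup>2) + 1"
        by (simp add: power2_eq_square algebra_simps)
      moreover have "0 \<le> t * d k x" using t by (simp add: d_def)
      ultimately have "t * d k x \<le> t * (t * (d k x)\<^sup>2 + 1 / t)"
        using t by (simp add: distrib_left)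
      then have "d k x \<le> t * (d k x)\<^sup>2 + 1 / t" using t(1) by (rule mult_left_le_imp_le)
      then show "norm (d k x) \<le> 2 ^ k * (d k x)\<^sup>2 + (1 / 2) ^ k"
        unfolding t(2) unfolding t_def by (simp add: d_def)
    qed
    then have "summable (\<lambda>k. F (Suc k) x - F k x)"
      unfolding d_def by (rule summable_norm_cancel)
    then have "convergent (\<lambda>n. \<Sum>k<n. F (Suc k) x - F k x)"
      by (simp add: summable_iff_convergent)
    then have "convergent (\<lambda>n. F n x - F 0 x)"
      using sum_lessThan_telescope[of "\<lambda>k. F k x"] by simp
    then have "convergent (\<lambda>n. (F n x - F 0 x) + F 0 x)"
      by (rule convergent_add[OF _ convergent_const])
    then show ?case by (simp add: convergent_LIMSEQ_iff)
  qed
qed measurable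

subsection \<open>The Fourier transform on square integrable functions\<close>

definition trunc :: "real \<Rightarrow> (real^'n \<Rightarrow> complex) \<Rightarrow> real^'n \<Rightarrow> complex" where
  "trunc R f = (\<lambda>x. indicator (cball 0 R) x * f x)"

lemma trunc_measurable [measurable]:
  assumes [measurable]: "f \<in> borel_measurable borel"
  shows "trunc R f \<in> borel_measurable borel"
proof -
  have [measurable]: "cball 0 R \<in> sets (borel :: (real^'n) measure)" by simp
  show ?thesis unfolding trunc_def by measurable
qed

text \<open>The squared norm takes values in \<open>ennreal\<close>, so that Fatou's lemma and
  limits apply before membership in \<open>L2\<close> is known.\<close>

definition sq_int :: "(real^'n \<Rightarrow> complex) \<Rightarrow> ennreal" where
  "sq_int f = (\<integral>\<^sup>+x. ennreal ((cmod (f x))\<^sup>2) \<partial>lborel)"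

lemma L2_measurable: "f \<in> L2 \<Longrightarrow> f \<in> borel_measurable borel"
  by (simp add: L2_def)

lemma L2_iff_sq_int: "f \<in> L2 \<longleftrightarrow> f \<in> borel_measurable borel \<and> sq_int f < \<infinity>"
  by (auto simp: L2_def sq_int_def integrable_iff_bounded)

lemma sq_int_L2_norm:
  assumes "f \<in> L2"
  shows "sq_int f = ennreal ((L2_norm f)\<^sup>2)"
proof -
  have "integrable lborel (\<lambda>x. (cmod (f x))\<^sup>2)" using assms by (simp add: L2_def)
  then have "sq_int f = ennreal (LINT x|lborel. (cmod (f x))\<^sup>2)"
    unfolding sq_int_def by (rule nn_integral_eq_integral) simp
  then show ?thesis by (simp add: L2_norm_def integral_nonneg_AE)
qed

text \<open>Pointwise (a + b)^2 \<le> 2 a^2 + 2 b^2. The factor 2 does no harm, since the uses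
  concern finiteness and convergence to 0.\<close>

lemma sq_int_triangle:
  assumes [measurable]: "f \<in> borel_measurable borel" "g \<in> borel_measurable borel" "h \<in> borel_measurable borel"
  shows "sq_int (\<lambda>x. f x - h x) \<le> 2 * sq_int (\<lambda>x. f x - g x) + 2 * sq_int (\<lambda>x. g x - h x)"
proof -
  have "sq_int (\<lambda>x. f x - h x) \<le> (\<integral>\<^sup>+x. 2 * ennreal ((cmod (f x - g x))\<^sup>2) + 2 * ennreal ((cmod (g x - h x))\<^sup>2) \<partial>lborel)"
    unfolding sq_int_def
  proof (rule nn_integral_mono)
    fix x
    have "cmod (f x - h x) \<le> cmod (f x - g x) + cmod (g x - h x)"
      using norm_triangle_ineq[of "f x - g x" "g x - h x"] by simp
    then have "(cmod (f x - h x))\<^sup>2 \<le> (cmod (f x - g x) + cmod (g x - h x))\<^sup>2" by (intro power_mono) auto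
    also have "\<dots> \<le> 2 * (cmod (f x - g x))\<^sup>2 + 2 * (cmod (g x - h x))\<^sup>2"
      using sum_squares_bound[of "cmod (f x - g x)" "cmod (g x - h x)"] by (simp add: power2_sum)
    finally have "ennreal ((cmod (f x - h x))\<^sup>2) \<le> ennreal (2 * (cmod (f x - g x))\<^sup>2 + 2 * (cmod (g x - h x))\<^sup>2)"
      by (rule ennreal_leI)
    then show "ennreal ((cmod (f x - h x))\<^sup>2) \<le> 2 * ennreal ((cmod (f x - g x))\<^sup>2) + 2 * ennreal ((cmod (g x - h x))\<^sup>2)"
      by (simp add: ennreal_plus ennreal_mult)
  qed
  also have "\<dots> = 2 * sq_int (\<lambda>x. f x - g x) + 2 * sq_int (\<lambda>x. g x - h x)"
    unfolding sq_int_def by (simp add: nn_integral_add nn_integral_cmult)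
  finally show ?thesis .
qed

lemma L2_diff:
  assumes "f \<in> L2" "g \<in> L2"
  shows "(\<lambda>x. f x - g x) \<in> L2"
proof -
  have [measurable]: "f \<in> borel_measurable borel" "g \<in> borel_measurable borel" using assms by (auto simp: L2_measurable)
  have "sq_int (\<lambda>x. f x - g x) \<le> 2 * sq_int (\<lambda>x. f x - 0) + 2 * sq_int (\<lambda>x. 0 - g x)"
    by (rule sq_int_triangle) auto
  also have "\<dots> < \<infinity>" using assms by (simp add: L2_iff_sq_int sq_int_def ennreal_mult_less_top)
  finally show ?thesis by (simp add: L2_iff_sq_int)
qed

text \<open>On a ball, which has finite measure, |f| is dominated by 1 + |f|^2.\<close>

lemma trunc_integrable:
  assumes f: "f \<in> L2"
  shows "integrable lborel (trunc R f)"
proof (rule Bochner_Integration.integrable_bound)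
  have [measurable]: "f \<in> borel_measurable borel" using f by (rule L2_measurable)
  show "integrable lborel (\<lambda>x. indicator (cball 0 R) x + (cmod (f x))\<^sup>2 :: real)"
  proof (intro Bochner_Integration.integrable_add)
    show "integrable lborel (indicator (cball (0::real^'n) R) :: _ \<Rightarrow> real)"
      by (intro integrable_real_indicator emeasure_lborel_cball_finite) auto
    show "integrable lborel (\<lambda>x. (cmod (f x))\<^sup>2)" using f by (simp add: L2_def)
  qed
  show "AE x in lborel. norm (trunc R f x) \<le> norm (indicator (cball 0 R) x + (cmod (f x))\<^sup>2)"
  proof (rule AE_I2)
    fix x
    have "0 \<le> (cmod (f x) - 1)\<^sup>2 + 1 + (cmod (f x))\<^sup>2" by (intro add_nonneg_nonneg) auto
    then have "cmod (f x) \<le> 1 + (cmod (f x))\<^sup>2" by (simp add: power2_diff)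
    then show "norm (trunc R f x) \<le> norm (indicator (cball 0 R) x + (cmod (f x))\<^sup>2)"
      by (auto simp: trunc_def indicator_def)
  qed
  show "trunc R f \<in> borel_measurable lborel" by measurable
qed

lemma fourier_integral_eq_osc:
  "fourier_integral f \<xi> = complex_of_real ((2 * pi) powr (- real CARD('n) / 2)) * osc_integral f \<xi>"
  for f :: "real^'n \<Rightarrow> complex"
  by (simp add: fourier_integral_def osc_integral_def)

lemma fourier_integral_measurable [measurable]:
  assumes [measurable]: "f \<in> borel_measurable borel"
  shows "fourier_integral f \<in> borel_measurable borel"
  unfolding fourier_integral_eq_osc[abs_def] by measurable

lemma fourier_integral_diff:
  assumes "integrable lborel f" "integrable lborel g"
  shows "fourier_integral (\<lambda>x. f x - g x) \<xi> = fourier_integral f \<xi> - fourier_integral g \<xi>"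
proof -
  have "integrable lborel (\<lambda>x. cis (- (x \<bullet> \<xi>)) * h x)" if "integrable lborel h" for h
    using that by (intro integrable_times_bounded) auto
  then show ?thesis using assms
    by (simp add: fourier_integral_def right_diff_distrib)
qed

lemma fourier_integral_bessel:
  fixes f :: "real^'n \<Rightarrow> complex"
  assumes f: "integrable lborel f"
  shows "sq_int (fourier_integral f) \<le> sq_int f"
proof -
  define c where "c = (2 * pi) powr (- real CARD('n) / 2)"
  have [measurable]: "f \<in> borel_measurable borel" using f by auto
  have c: "c\<^sup>2 * (2 * pi) ^ DIM(real^'n) = 1"
  proof -
    have "c\<^sup>2 = (2 * pi) powr (- real CARD('n))" unfolding c_def power2_eq_square
      by (simp flip: powr_add)
    moreover have "(2 * pi) ^ DIM(real^'n) = (2 * pi) powr (real CARD('n))"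
      by (simp add: powr_realpow)
    ultimately show ?thesis by (simp flip: powr_add)
  qed
  have "sq_int (fourier_integral f) = (\<integral>\<^sup>+\<xi>. ennreal (c\<^sup>2) * ennreal ((cmod (osc_integral f \<xi>))\<^sup>2) \<partial>lborel)"
    unfolding sq_int_def fourier_integral_eq_osc c_def
    by (simp add: norm_mult power_mult_distrib ennreal_mult)
  also have "\<dots> = ennreal (c\<^sup>2) * (\<integral>\<^sup>+\<xi>. ennreal ((cmod (osc_integral f \<xi>))\<^sup>2) \<partial>lborel)"
    by (rule nn_integral_cmult) measurable
  also have "\<dots> \<le> ennreal (c\<^sup>2) * (ennreal ((2 * pi) ^ DIM(real^'n)) * sq_int f)"
    unfolding sq_int_def by (intro mult_left_mono osc_integral_bessel f) auto
  also have "\<dots> = ennreal (c\<^sup>2 * (2 * pi) ^ DIM(real^'n)) * sq_int f"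
    by (subst ennreal_mult) (auto simp: mult.assoc)
  finally show ?thesis unfolding c by simp
qed

definition tail_int :: "real \<Rightarrow> (real^'n \<Rightarrow> complex) \<Rightarrow> ennreal" where
  "tail_int R f = (\<integral>\<^sup>+x. indicator (- cball 0 R) x * ennreal ((cmod (f x))\<^sup>2) \<partial>lborel)"

lemma tail_int_tendsto_0:
  fixes f :: "real^'n \<Rightarrow> complex"
  assumes f: "f \<in> L2"
  shows "((\<lambda>R. tail_int R f) \<longlongrightarrow> 0) at_top"
proof (rule tendsto_at_topI_sequentially)
  fix X :: "nat \<Rightarrow> real" assume X: "filterlim X at_top sequentially"
  have [measurable]: "f \<in> borel_measurable borel" using f by (rule L2_measurable)
  have "(\<lambda>k. \<integral>\<^sup>+x. indicator (- cball 0 (X k)) x * ennreal ((cmod (f x))\<^sup>2) \<partial>lborel) \<longlonglongrightarrow> (\<integral>\<^sup>+(x::real^'n). 0 \<partial>lborel)"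
  proof (rule nn_integral_dominated_convergence[where w = "\<lambda>x. ennreal ((cmod (f x))\<^sup>2)"])
    show "AE x in lborel. (\<lambda>k. indicator (- cball 0 (X k)) x * ennreal ((cmod (f x))\<^sup>2)) \<longlonglongrightarrow> 0"
    proof (rule AE_I2, rule tendsto_eventually)
      fix x :: "real^'n"
      have "eventually (\<lambda>k. norm x \<le> X k) sequentially" using X by (simp add: filterlim_at_top)
      then show "eventually (\<lambda>k. indicator (- cball 0 (X k)) x * ennreal ((cmod (f x))\<^sup>2) = 0) sequentially"
        by eventually_elim simp
    qed
  qed (use f in \<open>auto simp: L2_iff_sq_int sq_int_def indicator_def\<close>)
  then show "(\<lambda>k. tail_int (X k) f) \<longlonglongrightarrow> 0" by (simp add: tail_int_def)
qed

text \<open>The difference of two truncations lives outside the smaller ball, and Bessel's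
  inequality passes its square integral on to the transforms.\<close>

lemma fourier_trunc_Cauchy:
  assumes f: "f \<in> L2"
  shows "sq_int (\<lambda>\<xi>. fourier_integral (trunc R f) \<xi> - fourier_integral (trunc S f) \<xi>) \<le> tail_int (min R S) f"
proof -
  have "sq_int (\<lambda>\<xi>. fourier_integral (trunc R f) \<xi> - fourier_integral (trunc S f) \<xi>) =
     sq_int (fourier_integral (\<lambda>x. trunc R f x - trunc S f x))"
    unfolding sq_int_def fourier_integral_diff[OF trunc_integrable[OF f] trunc_integrable[OF f]] ..
  also have "\<dots> \<le> sq_int (\<lambda>x. trunc R f x - trunc S f x)"
    by (intro fourier_integral_bessel Bochner_Integration.integrable_diff trunc_integrable f)
  also have "\<dots> \<le> tail_int (min R S) f"
    unfolding sq_int_def tail_int_def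
    by (intro nn_integral_mono) (auto simp: trunc_def indicator_def)
  finally show ?thesis .
qed

lemma sq_int_trunc_le: "sq_int (trunc R f) \<le> sq_int f"
  unfolding sq_int_def by (intro nn_integral_mono) (auto simp: trunc_def indicator_def)

text \<open>Along radii with rapidly decaying tails the transforms converge almost everywhere. Their
  limit G is then compared with every radius, because \<open>is_fourier_L2\<close> asks for the full
  limit in R. The norm bound is carried along to become the contraction property of
  \<open>fourier\<close>.\<close>

lemma fourier_L2_exists:
  fixes f :: "real^'n \<Rightarrow> complex"
  assumes f: "f \<in> L2"
  shows "\<exists>G. is_fourier_L2 f G \<and> sq_int G \<le> sq_int f"
proof -
  have [measurable]: "f \<in> borel_measurable borel" using f by (rule L2_measurable)
  have "\<exists>r. \<forall>R\<ge>r. tail_int R f < ennreal ((1 / 4) ^ k)" for k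
    using order_tendstoD(2)[OF tail_int_tendsto_0[OF f], of "ennreal ((1 / 4) ^ k)"]
    by (auto simp: eventually_at_top_linorder)
  then obtain r where r: "\<And>k R. r k \<le> R \<Longrightarrow> tail_int R f < ennreal ((1 / 4) ^ k)" by metis
  \<comment> \<open>The sum makes X increasing and at least \<open>r k\<close>; the summand
    \<open>real k\<close> makes it unbounded.\<close>
  define X where "X k = real k + (\<Sum>j\<le>k. \<bar>r j\<bar>)" for k
  have Xmono: "X k \<le> X (Suc k)" for k by (simp add: X_def)
  have Xr: "r k \<le> X k" for k
    using member_le_sum[of k "{..k}" "\<lambda>j. \<bar>r j\<bar>"] by (simp add: X_def)
  have Xinf: "filterlim X at_top sequentially"
    by (rule filterlim_at_top_mono[OF filterlim_real_sequentially]) (auto simp: X_def intro!: sum_nonneg)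
  define F where "F k = fourier_integral (trunc (X k) f)" for k
  have Fm [measurable]: "F k \<in> borel_measurable borel" for k unfolding F_def by measurable
  have "\<exists>G \<in> borel_measurable lborel. AE x in lborel. (\<lambda>k. F k x) \<longlonglongrightarrow> G x"
  proof (rule L2_Cauchy_sequence_converges)
    fix k
    have "sq_int (\<lambda>x. F (Suc k) x - F k x) \<le> tail_int (min (X (Suc k)) (X k)) f"
      unfolding F_def by (rule fourier_trunc_Cauchy[OF f])
    also have "min (X (Suc k)) (X k) = X k" using Xmono by (simp add: min_def antisym)
    also have "tail_int (X k) f \<le> ennreal ((1 / 4) ^ k)" using r[OF Xr] by (rule less_imp_le)
    finally show "(\<integral>\<^sup>+x. ennreal ((cmod (F (Suc k) x - F k x))\<^sup>2) \<partial>lborel) \<le> ennreal ((1 / 4) ^ k)"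
      by (simp add: sq_int_def)
  qed auto
  then obtain G where Gm [measurable]: "G \<in> borel_measurable borel" and G: "AE x in lborel. (\<lambda>k. F k x) \<longlonglongrightarrow> G x"
    by auto
  \<comment> \<open>Used for two choices of H: zero yields the norm bound, a truncated transform
    yields convergence as R grows.\<close>
  have fatou: "sq_int (\<lambda>x. H x - G x) \<le> B" if [measurable]: "H \<in> borel_measurable borel"
    and B: "eventually (\<lambda>k. sq_int (\<lambda>x. H x - F k x) \<le> B) sequentially" for H B
  proof -
    have "sq_int (\<lambda>x. H x - G x) = (\<integral>\<^sup>+x. liminf (\<lambda>k. ennreal ((cmod (H x - F k x))\<^sup>2)) \<partial>lborel)"
      unfolding sq_int_def
    proof (rule nn_integral_cong_AE)
      show "AE x in lborel. ennreal ((cmod (H x - G x))\<^sup>2) = liminf (\<lambda>k. ennreal ((cmod (H x - F k x))\<^sup>2))"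
        using G
      proof eventually_elim
        case (elim x)
        have "(\<lambda>k. ennreal ((cmod (H x - F k x))\<^sup>2)) \<longlonglongrightarrow> ennreal ((cmod (H x - G x))\<^sup>2)"
          by (intro tendsto_intros tendsto_ennrealI elim)
        then show ?case by (rule lim_imp_Liminf[OF sequentially_bot, symmetric])
      qed
    qed
    also have "\<dots> \<le> liminf (\<lambda>k. sq_int (\<lambda>x. H x - F k x))"
      unfolding sq_int_def by (rule nn_integral_liminf) measurable
    also have "\<dots> \<le> B" by (rule Liminf_le[OF _ B]) simp
    finally show ?thesis .
  qed
  have norm: "sq_int G \<le> sq_int f"
  proof -
    have "sq_int (\<lambda>x. 0 - G x) \<le> sq_int f"
    proof (rule fatou)
      have "sq_int (\<lambda>x. 0 - F k x) \<le> sq_int f" for k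
        using fourier_integral_bessel[OF trunc_integrable[OF f, of "X k"]] sq_int_trunc_le[of "X k" f]
        by (simp add: F_def sq_int_def)
      then show "eventually (\<lambda>k. sq_int (\<lambda>x. 0 - F k x) \<le> sq_int f) sequentially" by simp
    qed auto
    then show ?thesis by (simp add: sq_int_def)
  qed
  have tl: "sq_int (\<lambda>\<xi>. fourier_integral (trunc R f) \<xi> - G \<xi>) \<le> tail_int R f" for R
  proof (rule fatou)
    have "eventually (\<lambda>k. R \<le> X k) sequentially" using Xinf by (simp add: filterlim_at_top)
    then show "eventually (\<lambda>k. sq_int (\<lambda>\<xi>. fourier_integral (trunc R f) \<xi> - F k \<xi>) \<le> tail_int R f) sequentially"
    proof eventually_elim
      case (elim k)
      then show ?case using fourier_trunc_Cauchy[OF f, of R "X k"] by (simp add: F_def min_def)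
    qed
  qed measurable
  have "((\<lambda>R. sq_int (\<lambda>\<xi>. fourier_integral (trunc R f) \<xi> - G \<xi>)) \<longlongrightarrow> 0) at_top"
    by (rule tendsto_sandwich[OF _ _ tendsto_const tail_int_tendsto_0[OF f]]) (use tl in auto)
  moreover have "G \<in> L2" using norm f Gm by (auto simp: L2_iff_sq_int)
  ultimately have "is_fourier_L2 f G" by (simp add: is_fourier_L2_def sq_int_def trunc_def)
  with norm show ?thesis by blast
qed

lemma is_fourier_L2_props:
  assumes "is_fourier_L2 f G"
  shows "G \<in> L2" "((\<lambda>R. sq_int (\<lambda>\<xi>. fourier_integral (trunc R f) \<xi> - G \<xi>)) \<longlongrightarrow> 0) at_top"
  using assms by (auto simp: is_fourier_L2_def sq_int_def trunc_def)

lemma is_fourier_L2_diff: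
  assumes f: "f \<in> L2" and g: "g \<in> L2"
    and F: "is_fourier_L2 f F" and G: "is_fourier_L2 g G"
  shows "is_fourier_L2 (\<lambda>x. f x - g x) (\<lambda>\<xi>. F \<xi> - G \<xi>)"
proof -
  note F = is_fourier_L2_props[OF F] and G = is_fourier_L2_props[OF G]
  have [measurable]: "f \<in> borel_measurable borel" "g \<in> borel_measurable borel" "F \<in> borel_measurable borel" "G \<in> borel_measurable borel"
    using f g F G by (auto intro: L2_measurable)
  have le: "sq_int (\<lambda>\<xi>. fourier_integral (trunc R (\<lambda>x. f x - g x)) \<xi> - (F \<xi> - G \<xi>)) \<le>
    2 * sq_int (\<lambda>\<xi>. fourier_integral (trunc R f) \<xi> - F \<xi>) + 2 * sq_int (\<lambda>\<xi>. fourier_integral (trunc R g) \<xi> - G \<xi>)" for R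
  proof -
    have "trunc R (\<lambda>x. f x - g x) = (\<lambda>x. trunc R f x - trunc R g x)"
      by (simp add: trunc_def right_diff_distrib)
    then have "sq_int (\<lambda>\<xi>. fourier_integral (trunc R (\<lambda>x. f x - g x)) \<xi> - (F \<xi> - G \<xi>)) =
      sq_int (\<lambda>\<xi>. (fourier_integral (trunc R f) \<xi> - F \<xi>) - (fourier_integral (trunc R g) \<xi> - G \<xi>))"
      by (simp add: fourier_integral_diff[OF trunc_integrable[OF f] trunc_integrable[OF g]] algebra_simps)
    also have "\<dots> \<le> 2 * sq_int (\<lambda>\<xi>. (fourier_integral (trunc R f) \<xi> - F \<xi>) - 0) + 2 * sq_int (\<lambda>\<xi>. 0 - (fourier_integral (trunc R g) \<xi> - G \<xi>))"
      by (rule sq_int_triangle) measurable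
    finally show ?thesis by (simp add: sq_int_def norm_minus_commute)
  qed
  have two: "(2::ennreal) < top" by (simp add: less_top[symmetric])
  have "((\<lambda>R. 2 * sq_int (\<lambda>\<xi>. fourier_integral (trunc R f) \<xi> - F \<xi>) + 2 * sq_int (\<lambda>\<xi>. fourier_integral (trunc R g) \<xi> - G \<xi>)) \<longlongrightarrow> 2 * 0 + 2 * 0) at_top"
    by (rule tendsto_add[OF ennreal_tendsto_cmult[OF two F(2)] ennreal_tendsto_cmult[OF two G(2)]])
  then have "((\<lambda>R. sq_int (\<lambda>\<xi>. fourier_integral (trunc R (\<lambda>x. f x - g x)) \<xi> - (F \<xi> - G \<xi>))) \<longlongrightarrow> 0) at_top"
    by (intro tendsto_sandwich[OF _ always_eventually[OF allI[OF le]] tendsto_const]) simp_all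
  then show ?thesis using L2_diff[OF F(1) G(1)] by (simp add: is_fourier_L2_def sq_int_def trunc_def)
qed

text \<open>The difference of two transforms of f is a transform of f - f, whose truncated integrals
  vanish. The quantity that tends to 0 is then constant in R, hence 0.\<close>

lemma is_fourier_L2_unique:
  assumes f: "f \<in> L2" and F: "is_fourier_L2 f F" and G: "is_fourier_L2 f G"
  shows "AE \<xi> in lborel. F \<xi> = G \<xi>"
proof -
  have "is_fourier_L2 (\<lambda>x. f x - f x) (\<lambda>\<xi>. F \<xi> - G \<xi>)"
    by (rule is_fourier_L2_diff[OF f f F G])
  from is_fourier_L2_props(2)[OF this] have "((\<lambda>R::real. sq_int (\<lambda>\<xi>. F \<xi> - G \<xi>)) \<longlongrightarrow> 0) at_top"
    by (simp add: trunc_def fourier_integral_def sq_int_def norm_minus_commute)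
  then have "sq_int (\<lambda>\<xi>. F \<xi> - G \<xi>) = 0"
    by (rule tendsto_unique[OF trivial_limit_at_top_linorder tendsto_const])
  moreover have "(\<lambda>\<xi>. ennreal ((cmod (F \<xi> - G \<xi>))\<^sup>2)) \<in> borel_measurable lborel"
    using is_fourier_L2_props(1)[OF F] is_fourier_L2_props(1)[OF G] by (auto dest!: L2_measurable)
  ultimately show ?thesis
    by (auto simp: sq_int_def nn_integral_0_iff_AE)
qed

lemma is_fourier_L2_fourier:
  assumes "f \<in> L2"
  shows "is_fourier_L2 f (fourier f)"
  unfolding fourier_def using fourier_L2_exists[OF assms] by (metis someI)

lemma fourier_in_L2: "f \<in> L2 \<Longrightarrow> fourier f \<in> L2"
  using is_fourier_L2_fourier is_fourier_L2_props(1) by blast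

lemma sq_int_cong_AE: "AE x in lborel. f x = g x \<Longrightarrow> sq_int f = sq_int g"
  unfolding sq_int_def by (intro nn_integral_cong_AE) auto

text \<open>Existence supplies one transform with this bound, and uniqueness moves the bound to the
  representative chosen by \<open>fourier\<close>.\<close>

lemma sq_int_fourier_le:
  assumes "f \<in> L2"
  shows "sq_int (fourier f) \<le> sq_int f"
proof -
  obtain G where "is_fourier_L2 f G" "sq_int G \<le> sq_int f" using fourier_L2_exists[OF assms] by blast
  moreover from this have "sq_int (fourier f) = sq_int G"
    by (intro sq_int_cong_AE is_fourier_L2_unique[OF assms is_fourier_L2_fourier[OF assms]])
  ultimately show ?thesis by simp
qed

lemma fourier_diff:
  assumes "f \<in> L2" "g \<in> L2"
  shows "AE \<xi> in lborel. fourier (\<lambda>x. f x - g x) \<xi> = fourier f \<xi> - fourier g \<xi>"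
  by (intro is_fourier_L2_unique[OF L2_diff[OF assms]] is_fourier_L2_diff assms is_fourier_L2_fourier L2_diff)

text \<open>The choice in \<open>fourier\<close> is made for each function separately; contraction
  applied to the difference identifies the two choices. This lets g take the place of
  \<open>u T\<close>.\<close>

lemma fourier_cong_AE:
  fixes f g :: "real^'n \<Rightarrow> complex"
  assumes "f \<in> L2" "g \<in> L2" "AE x in lborel. f x = g x"
  shows "AE \<xi> in lborel. fourier f \<xi> = fourier g \<xi>"
proof -
  have d: "(\<lambda>x. f x - g x) \<in> L2" by (intro L2_diff assms)
  have "sq_int (\<lambda>x. f x - g x) = sq_int (\<lambda>x::real^'n. 0)"
    by (rule sq_int_cong_AE) (use assms(3) in auto)
  then have "sq_int (fourier (\<lambda>x. f x - g x)) = 0"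
    using sq_int_fourier_le[OF d] by (simp add: sq_int_def)
  moreover have "fourier (\<lambda>x. f x - g x) \<in> borel_measurable borel"
    by (intro L2_measurable fourier_in_L2 d)
  ultimately have "AE \<xi> in lborel. fourier (\<lambda>x. f x - g x) \<xi> = 0"
    by (auto simp: sq_int_def nn_integral_0_iff_AE)
  with fourier_diff[OF assms(1,2)] show ?thesis by eventually_elim simp
qed

subsection \<open>Spectral filtering with the discrepancy principle\<close>

text \<open>Young's inequality with a free weight: a coefficient close to 1 on the noise preserves
  the gap left by \<theta> > 1. Where no gap is at stake, \<eta> = 1 gives the factor 2.\<close>

lemma norm_add_power2_le:
  fixes a b :: complex and \<eta> :: real
  assumes "0 < \<eta>"
  shows "(cmod (a + b))\<^sup>2 \<le> (1 + \<eta>) * (cmod a)\<^sup>2 + (1 + 1 / \<eta>) * (cmod b)\<^sup>2"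
proof -
  have "(cmod (a + b))\<^sup>2 \<le> (cmod a + cmod b)\<^sup>2"
    by (intro power_mono norm_triangle_ineq) auto
  also have "\<dots> \<le> (1 + \<eta>) * (cmod a)\<^sup>2 + (1 + 1 / \<eta>) * (cmod b)\<^sup>2"
  proof -
    have "0 \<le> (\<eta> * cmod a - cmod b)\<^sup>2 / \<eta>" using assms by simp
    also have "\<dots> = \<eta> * (cmod a)\<^sup>2 - 2 * cmod a * cmod b + (cmod b)\<^sup>2 / \<eta>"
      using assms by (simp add: field_simps power2_eq_square)
    finally show ?thesis by (simp add: power2_sum algebra_simps)
  qed
  finally show ?thesis .
qed

text \<open>A pointwise interpolation between the exponents -2 and p: the first term suffices below
  the threshold N, the second above it. N stays free so that it can balance the resulting
  integrals.\<close>

lemma powr_interpolation: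
  fixes y N l p :: real
  assumes "0 < y" "0 < N" "- 2 \<le> l" "l \<le> p"
  shows "y powr l \<le> N powr (l + 2) * y powr (- 2) + N powr (l - p) * y powr p"
proof (cases "y \<le> N")
  case True
  have "y powr l = y powr (l + 2) * y powr (- 2)" by (simp flip: powr_add)
  also have "\<dots> \<le> N powr (l + 2) * y powr (- 2)"
    using assms True by (intro mult_right_mono powr_mono2) auto
  finally show ?thesis by (smt (verit) mult_nonneg_nonneg powr_ge_zero)
next
  case False
  have "y powr l = y powr (l - p) * y powr p" by (simp flip: powr_add)
  also have "\<dots> \<le> N powr (l - p) * y powr p"
    using assms False by (intro mult_right_mono powr_mono2') auto
  finally show ?thesis by (smt (verit) mult_nonneg_nonneg powr_ge_zero)
qed

text \<open>
  With \<open>N = (E / \<delta>)\<^bsup>2 / (p + 2)\<^esup>\<close> as in the proof of \<open>filtered_error_bound\<close>, the discrepancy equation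
  yields \<open>A \<le> filter_const \<theta> c2 \<kappa> p * N\<close>; in the application \<open>A = max 1 (1 / \<alpha>\<^sup>2)\<close>.
\<close>

definition filter_const :: "real \<Rightarrow> real \<Rightarrow> real \<Rightarrow> real \<Rightarrow> real" where
  "filter_const \<theta> c2 \<kappa> p =
    (let \<eta> = (\<theta>\<^sup>2 - 1) / 2 in ((1 + 1 / \<eta>) * (\<kappa> * c2\<^sup>2) / \<eta>) powr (1 / (p + 2)))"

text \<open>In units of \<open>N powr (l + 2) * \<delta>\<^sup>2\<close>, the three summands account
  for (1 - m) w measured with y^-2, for (1 - m) w measured with y^p, and for the amplified
  noise.\<close>

definition error_const :: "real \<Rightarrow> real \<Rightarrow> real \<Rightarrow> real \<Rightarrow> real \<Rightarrow> real \<Rightarrow> real \<Rightarrow> real" where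
  "error_const \<theta> c1 c2 \<kappa> K p l =
    4 * (\<theta>\<^sup>2 + 1) / c1\<^sup>2 + 2 + 2 * K * filter_const \<theta> c2 \<kappa> p powr (l + 2) / c1\<^sup>2"

text \<open>Frequency space appears only as a measure space with a weight y and multipliers. The
  functions w, h, hd stand for the transforms of the initial value, the exact data and the noisy
  data, e and e' for the factors at times T and t, and F for the error. A is the scale of y at which
  the filter m turns from passing to damping.\<close>

lemma filtered_error_bound:
  fixes M :: "'a measure" and w h hd F :: "'a \<Rightarrow> complex" and y e e' m :: "'a \<Rightarrow> real"
  assumes pos: "0 < \<delta>" "0 < E" "1 < \<theta>" "0 < p" "0 \<le> l" "l \<le> p" "0 < c1" "0 < \<kappa>" "0 \<le> K" "0 < A"
    and y: "\<And>x. 1 \<le> y x"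
    and e: "\<And>x. c1 / y x \<le> e x" "\<And>x. e x \<le> c2 / y x"
    and e': "\<And>x. 0 \<le> e' x" "\<And>x. e' x \<le> 1"
    and m: "\<And>x. 0 \<le> m x" "\<And>x. m x \<le> 1"
    and mlow: "\<And>x. (1 - m x)\<^sup>2 \<le> \<kappa> * (y x / A) powr (p + 2)"
    and mhigh: "\<And>x. (m x)\<^sup>2 * y x powr (l + 2) \<le> K * A powr (l + 2)"
    and h: "AE x in M. h x = w x * complex_of_real (e x)"
    and F: "AE x in M. F x = w x * complex_of_real (e' x) - complex_of_real (e' x / e x * m x) * hd x"
    and ym: "y \<in> borel_measurable M"
    and Fm: "F \<in> borel_measurable M"
    and iw: "integrable M (\<lambda>x. y x powr p * (cmod (w x))\<^sup>2)" "(LINT x|M. y x powr p * (cmod (w x))\<^sup>2) \<le> E\<^sup>2"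
    and iD: "integrable M (\<lambda>x. (cmod (h x - hd x))\<^sup>2)" "(LINT x|M. (cmod (h x - hd x))\<^sup>2) \<le> \<delta>\<^sup>2"
    and ihd: "integrable M (\<lambda>x. (1 - m x)\<^sup>2 * (cmod (hd x))\<^sup>2)" "(LINT x|M. (1 - m x)\<^sup>2 * (cmod (hd x))\<^sup>2) = (\<theta> * \<delta>)\<^sup>2"
  shows "integrable M (\<lambda>x. y x powr l * (cmod (F x))\<^sup>2) \<and>
    (LINT x|M. y x powr l * (cmod (F x))\<^sup>2) \<le>
       error_const \<theta> c1 c2 \<kappa> K p l * (E powr ((2 + l) / (p + 2)) * \<delta> powr ((p - l) / (p + 2)))\<^sup>2"
proof -
  \<comment> \<open>Half of the gap: of \<theta>^2 = 1 + 2 \<eta> the noise receives the share 1 +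
    \<eta>, and \<eta> remains for the exact data.\<close>
  define \<eta> where "\<eta> = (\<theta>\<^sup>2 - 1) / 2"
  have th: "1 < \<theta>\<^sup>2" using pos by simp
  have \<eta>: "0 < \<eta>" "\<theta>\<^sup>2 = 1 + 2 * \<eta>" using th by (auto simp: \<eta>_def field_simps)
  have e0: "0 < e x" for x using y[of x] e(1)[of x] pos by (smt (verit) divide_pos_pos)
  have c2: "0 < c2" using y[of undefined] e0[of undefined] e(2)[of undefined] by (smt (verit) divide_nonpos_pos)
  have y0: "0 < y x" for x using y[of x] by simp
  have m1: "(1 - m x)\<^sup>2 \<le> 1" for x using m[of x] by (simp add: power_le_one)
  define N where "N = (E / \<delta>) powr (2 / (p + 2))"
  have N: "0 < N" using pos by (simp add: N_def)
  have Np: "N powr (p + 2) = (E / \<delta>)\<^sup>2"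
  proof -
    have "2 / (p + 2) * (p + 2) = 2" using pos by (intro nonzero_eq_divide_eq[THEN iffD1]) auto
    then show ?thesis using pos by (simp only: N_def powr_powr powr_numeral) simp
  qed
  have nm: "(cmod (complex_of_real (1 - m x) * z))\<^sup>2 = (1 - m x)\<^sup>2 * (cmod z)\<^sup>2" for x z
    by (simp only: norm_mult norm_of_real power_mult_distrib power2_abs)
  define D where "D x = (cmod (h x - hd x))\<^sup>2" for x
  define S where "S x = (1 - m x)\<^sup>2 * (cmod (hd x))\<^sup>2" for x
  define P where "P x = y x powr p * (cmod (w x))\<^sup>2" for x
  note iw = iw[folded P_def] and iD = iD[folded D_def] and ihd = ihd[folded S_def]
  have D0: "0 \<le> D x" and S0: "0 \<le> S x" and P0: "0 \<le> P x" for x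
    by (auto simp: D_def S_def P_def)
  define L where "L = (1 + 1 / \<eta>) * (\<kappa> * c2\<^sup>2)"
  have L: "0 < L" unfolding L_def using \<eta> pos c2 by (intro mult_pos_pos add_pos_pos) auto
  have low: "AE x in M. S x \<le> (1 + \<eta>) * D x + L * A powr (- (p + 2)) * P x"
    using h
  proof eventually_elim
    case (elim x)
    have "S x = (cmod (complex_of_real (1 - m x) * (hd x - h x) + complex_of_real (1 - m x) * h x))\<^sup>2"
      unfolding distrib_left[symmetric] nm by (simp add: S_def)
    also have "\<dots> \<le> (1 + \<eta>) * (cmod (complex_of_real (1 - m x) * (hd x - h x)))\<^sup>2 + (1 + 1 / \<eta>) * (cmod (complex_of_real (1 - m x) * h x))\<^sup>2"
      by (rule norm_add_power2_le[OF \<eta>(1)])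
    also have "\<dots> \<le> (1 + \<eta>) * D x + (1 + 1 / \<eta>) * (\<kappa> * c2\<^sup>2 * A powr (- (p + 2)) * P x)"
    proof (intro add_mono mult_left_mono)
      have "(1 - m x)\<^sup>2 * (cmod (hd x - h x))\<^sup>2 \<le> (cmod (hd x - h x))\<^sup>2"
        using m1[of x] by (intro mult_left_le_one_le) auto
      then show "(cmod (complex_of_real (1 - m x) * (hd x - h x)))\<^sup>2 \<le> D x"
        unfolding nm by (simp add: D_def norm_minus_commute)
      have "(cmod (complex_of_real (1 - m x) * h x))\<^sup>2 = (1 - m x)\<^sup>2 * ((e x)\<^sup>2 * (cmod (w x))\<^sup>2)"
        unfolding nm by (simp add: elim norm_mult power_mult_distrib mult.commute)
      also have "\<dots> \<le> (\<kappa> * (y x / A) powr (p + 2)) * ((c2 / y x)\<^sup>2 * (cmod (w x))\<^sup>2)"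
        using e0[of x] pos by (intro mult_mono mlow power_mono e) auto
      also have "(y x / A) powr (p + 2) = y x powr (p + 2) * A powr (- (p + 2))"
        using y0[of x] pos powr_minus_divide[of A "p + 2"] by (simp add: powr_divide)
      also have "(c2 / y x)\<^sup>2 = c2\<^sup>2 * y x powr (- 2)"
        using y0[of x] by (simp add: power_divide powr_minus_divide)
      also have "\<kappa> * (y x powr (p + 2) * A powr (- (p + 2))) * (c2\<^sup>2 * y x powr (- 2) * (cmod (w x))\<^sup>2) =
         \<kappa> * c2\<^sup>2 * A powr (- (p + 2)) * ((y x powr (p + 2) * y x powr (- 2)) * (cmod (w x))\<^sup>2)"
        by (simp only: mult_ac)
      also have "y x powr (p + 2) * y x powr (- 2) = y x powr p" by (simp flip: powr_add)
      finally show "(cmod (complex_of_real (1 - m x) * h x))\<^sup>2 \<le> \<kappa> * c2\<^sup>2 * A powr (- (p + 2)) * P x"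
        by (simp add: P_def)
    qed (use \<eta> in auto)
    finally show ?case by (simp add: L_def mult_ac)
  qed
  have "(\<theta> * \<delta>)\<^sup>2 \<le> (LINT x|M. (1 + \<eta>) * D x + L * A powr (- (p + 2)) * P x)"
    unfolding ihd(2)[symmetric]
    by (intro integral_mono_AE low ihd Bochner_Integration.integrable_add integrable_mult_right iD iw)
  also have "\<dots> = (1 + \<eta>) * (LINT x|M. D x) + L * A powr (- (p + 2)) * (LINT x|M. P x)"
    using iD(1) iw(1) by simp
  also have "\<dots> \<le> (1 + \<eta>) * \<delta>\<^sup>2 + L * A powr (- (p + 2)) * E\<^sup>2"
    using \<eta> L by (intro add_mono mult_left_mono iD iw) auto
  \<comment> \<open>What is left after the noise share must be supplied by the exact data; solving
    for A bounds the filter scale by a multiple of N.\<close>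
  finally have "\<eta> * \<delta>\<^sup>2 \<le> L * A powr (- (p + 2)) * E\<^sup>2"
    by (simp add: power_mult_distrib \<eta>(2) algebra_simps)
  then have "A powr (p + 2) * (\<eta> * \<delta>\<^sup>2) \<le> A powr (p + 2) * (L * A powr (- (p + 2)) * E\<^sup>2)"
    by (intro mult_left_mono) auto
  also have "\<dots> = (A powr (p + 2) * A powr (- (p + 2))) * (L * E\<^sup>2)" by (simp only: mult_ac)
  also have "A powr (p + 2) * A powr (- (p + 2)) = 1" using pos by (simp flip: powr_add)
  finally have "A powr (p + 2) \<le> (L / \<eta>) * N powr (p + 2)"
    using \<eta> pos unfolding Np by (simp add: field_simps power_divide)
  then have "(A powr (p + 2)) powr (1 / (p + 2)) \<le> ((L / \<eta>) * N powr (p + 2)) powr (1 / (p + 2))"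
    using pos by (intro powr_mono2) auto
  moreover have "(A powr (p + 2)) powr (1 / (p + 2)) = A" using pos by (simp add: powr_powr)
  moreover have "(N powr (p + 2)) powr (1 / (p + 2)) = N" using pos N by (simp add: powr_powr)
  moreover have "(L / \<eta>) powr (1 / (p + 2)) = filter_const \<theta> c2 \<kappa> p"
    by (simp add: filter_const_def L_def \<eta>_def Let_def)
  ultimately have A: "A \<le> filter_const \<theta> c2 \<kappa> p * N"
    by (simp only: powr_mult)
  define R where "R = filter_const \<theta> c2 \<kappa> p powr (l + 2)"
  have AR: "A powr (l + 2) \<le> R * N powr (l + 2)"
    using powr_mono2[OF _ _ A, of "l + 2"] pos by (simp add: R_def powr_mult)
  have up: "AE x in M. y x powr l * (cmod (F x))\<^sup>2 \<le>
     2 * N powr (l + 2) / c1\<^sup>2 * (2 * S x + 2 * D x) + 2 * N powr (l - p) * P x + 2 * K * A powr (l + 2) / c1\<^sup>2 * D x"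
    using h F
  proof eventually_elim
    case (elim x)
    have inv: "1 / (e x)\<^sup>2 \<le> (y x)\<^sup>2 / c1\<^sup>2"
    proof -
      have "(c1 / y x)\<^sup>2 \<le> (e x)\<^sup>2" using e(1)[of x] pos y0[of x] by (intro power_mono) auto
      then show ?thesis using y0[of x] pos e0[of x] by (simp add: power_divide field_simps)
    qed
    \<comment> \<open>As w = h / e, the factor e' splits off and is at most 1. The remainder does
      not involve t, which makes the bound uniform in time.\<close>
    have "F x = complex_of_real (e' x) * (complex_of_real (1 - m x) * w x + complex_of_real (m x / e x) * (h x - hd x))"
      using e0[of x] by (simp add: elim field_simps)
    then have "(cmod (F x))\<^sup>2 = (e' x)\<^sup>2 * (cmod (complex_of_real (1 - m x) * w x + complex_of_real (m x / e x) * (h x - hd x)))\<^sup>2"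
      by (simp only: norm_mult power_mult_distrib norm_of_real power2_abs)
    also have "\<dots> \<le> (cmod (complex_of_real (1 - m x) * w x + complex_of_real (m x / e x) * (h x - hd x)))\<^sup>2"
      using e'[of x] by (intro mult_left_le_one_le) (auto simp: power_le_one)
    also have "\<dots> \<le> 2 * ((1 - m x)\<^sup>2 * (cmod (w x))\<^sup>2) + 2 * ((m x / e x)\<^sup>2 * D x)"
      using norm_add_power2_le[of 1 "complex_of_real (1 - m x) * w x" "complex_of_real (m x / e x) * (h x - hd x)"]
      by (simp only: norm_mult power_mult_distrib norm_of_real power2_abs D_def) simp
    finally have "y x powr l * (cmod (F x))\<^sup>2 \<le> y x powr l * (2 * ((1 - m x)\<^sup>2 * (cmod (w x))\<^sup>2) + 2 * ((m x / e x)\<^sup>2 * D x))"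
      by (intro mult_left_mono) auto
    also have "\<dots> = 2 * (y x powr l * ((1 - m x)\<^sup>2 * (cmod (w x))\<^sup>2)) + 2 * (y x powr l * (m x / e x)\<^sup>2) * D x"
      by (simp add: algebra_simps)
    also have "\<dots> \<le> 2 * (N powr (l + 2) / c1\<^sup>2 * (2 * S x + 2 * D x) + N powr (l - p) * P x) + 2 * (K * A powr (l + 2) / c1\<^sup>2) * D x"
    proof (intro add_mono mult_left_mono mult_right_mono D0)
      have "y x powr l * (m x / e x)\<^sup>2 = y x powr l * (m x)\<^sup>2 * (1 / (e x)\<^sup>2)" by (simp add: power_divide)
      also have "\<dots> \<le> y x powr l * (m x)\<^sup>2 * ((y x)\<^sup>2 / c1\<^sup>2)" by (intro mult_left_mono inv) auto
      also have "\<dots> = (m x)\<^sup>2 * y x powr (l + 2) / c1\<^sup>2" using y0[of x] by (simp add: powr_add)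
      also have "\<dots> \<le> K * A powr (l + 2) / c1\<^sup>2" by (intro divide_right_mono mhigh) auto
      finally show "y x powr l * (m x / e x)\<^sup>2 \<le> K * A powr (l + 2) / c1\<^sup>2" .
      have "y x powr l * ((1 - m x)\<^sup>2 * (cmod (w x))\<^sup>2) \<le>
         (N powr (l + 2) * y x powr (- 2) + N powr (l - p) * y x powr p) * ((1 - m x)\<^sup>2 * (cmod (w x))\<^sup>2)"
        using pos by (intro mult_right_mono powr_interpolation y0 N) auto
      also have "\<dots> = N powr (l + 2) * (y x powr (- 2) * ((1 - m x)\<^sup>2 * (cmod (w x))\<^sup>2)) + N powr (l - p) * ((1 - m x)\<^sup>2 * P x)"
        by (simp add: algebra_simps P_def)
      also have "\<dots> \<le> N powr (l + 2) * (1 / c1\<^sup>2 * (2 * S x + 2 * D x)) + N powr (l - p) * P x"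
      proof (intro add_mono mult_left_mono)
        show "(1 - m x)\<^sup>2 * P x \<le> P x" using m1[of x] P0 by (intro mult_left_le_one_le) auto
        \<comment> \<open>Under the weight y^-2 the unknown w can be traded for the data h, because
          1 / e costs at most y / c1; S and D then control the term.\<close>
        have "(cmod (w x))\<^sup>2 = (cmod (h x))\<^sup>2 * (1 / (e x)\<^sup>2)"
          using e0[of x] by (simp add: elim norm_mult power_mult_distrib)
        also have "\<dots> \<le> (cmod (h x))\<^sup>2 * ((y x)\<^sup>2 / c1\<^sup>2)" by (intro mult_left_mono inv) auto
        finally have wh: "(cmod (w x))\<^sup>2 \<le> (cmod (h x))\<^sup>2 * ((y x)\<^sup>2 / c1\<^sup>2)" .
        have "y x powr (- 2) * ((1 - m x)\<^sup>2 * (cmod (w x))\<^sup>2) \<le> y x powr (- 2) * ((1 - m x)\<^sup>2 * ((cmod (h x))\<^sup>2 * ((y x)\<^sup>2 / c1\<^sup>2)))"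
          by (intro mult_left_mono wh) auto
        also have "\<dots> = 1 / c1\<^sup>2 * (cmod (complex_of_real (1 - m x) * h x))\<^sup>2"
          unfolding nm using y0[of x] by (simp add: powr_minus_divide)
        also have "\<dots> \<le> 1 / c1\<^sup>2 * (2 * S x + 2 * D x)"
        proof (intro mult_left_mono)
          have "(cmod (complex_of_real (1 - m x) * h x))\<^sup>2 =
            (cmod (complex_of_real (1 - m x) * hd x + complex_of_real (1 - m x) * (h x - hd x)))\<^sup>2"
            unfolding distrib_left[symmetric] by simp
          also have "\<dots> \<le> 2 * S x + 2 * ((1 - m x)\<^sup>2 * D x)"
            using norm_add_power2_le[of 1 "complex_of_real (1 - m x) * hd x" "complex_of_real (1 - m x) * (h x - hd x)"]
            by (simp only: norm_mult power_mult_distrib norm_of_real power2_abs D_def S_def) simp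
          also have "\<dots> \<le> 2 * S x + 2 * D x"
            using m1[of x] D0 by (intro add_left_mono mult_left_mono mult_left_le_one_le) auto
          finally show "(cmod (complex_of_real (1 - m x) * h x))\<^sup>2 \<le> 2 * S x + 2 * D x" .
        qed auto
        finally show "y x powr (- 2) * ((1 - m x)\<^sup>2 * (cmod (w x))\<^sup>2) \<le> 1 / c1\<^sup>2 * (2 * S x + 2 * D x)" .
      qed auto
      finally show "y x powr l * ((1 - m x)\<^sup>2 * (cmod (w x))\<^sup>2) \<le> N powr (l + 2) / c1\<^sup>2 * (2 * S x + 2 * D x) + N powr (l - p) * P x"
        by simp
    qed auto
    finally show ?case by (simp add: algebra_simps)
  qed
  let ?G = "\<lambda>x. 2 * N powr (l + 2) / c1\<^sup>2 * (2 * S x + 2 * D x) + 2 * N powr (l - p) * P x + 2 * K * A powr (l + 2) / c1\<^sup>2 * D x"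
  have iG: "integrable M ?G"
    by (intro Bochner_Integration.integrable_add integrable_mult_right ihd iw iD)
  have int: "integrable M (\<lambda>x. y x powr l * (cmod (F x))\<^sup>2)"
  proof (rule Bochner_Integration.integrable_bound[OF iG])
    show "(\<lambda>x. y x powr l * (cmod (F x))\<^sup>2) \<in> borel_measurable M" using ym Fm by measurable
    show "AE x in M. norm (y x powr l * (cmod (F x))\<^sup>2) \<le> norm (?G x)"
      using up by eventually_elim simp
  qed
  have "(LINT x|M. y x powr l * (cmod (F x))\<^sup>2) \<le> (LINT x|M. ?G x)"
    by (intro integral_mono_AE int iG up)
  also have "\<dots> = 2 * N powr (l + 2) / c1\<^sup>2 * (2 * (LINT x|M. S x) + 2 * (LINT x|M. D x)) + 2 * N powr (l - p) * (LINT x|M. P x) + 2 * K * A powr (l + 2) / c1\<^sup>2 * (LINT x|M. D x)"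
    using ihd(1) iD(1) iw(1) by simp
  also have "\<dots> \<le> 2 * N powr (l + 2) / c1\<^sup>2 * (2 * (\<theta> * \<delta>)\<^sup>2 + 2 * \<delta>\<^sup>2) + 2 * N powr (l - p) * E\<^sup>2 + 2 * K * (R * N powr (l + 2)) / c1\<^sup>2 * \<delta>\<^sup>2"
    using pos ihd(2) iD(2) iw(2) AR
    by (intro add_mono mult_mono divide_right_mono) (auto intro!: integral_nonneg_AE add_nonneg_nonneg AE_I2 D0 P0 simp: R_def)
  \<comment> \<open>The choice of N makes the source term equal in size to the discrepancy
    term.\<close>
  also have "N powr (l - p) * E\<^sup>2 = N powr (l + 2) * \<delta>\<^sup>2"
  proof -
    have "N powr (l - p) = N powr (l + 2) / N powr (p + 2)" by (simp flip: powr_diff)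
    then show ?thesis using pos unfolding Np by (simp add: power_divide)
  qed
  then have "2 * N powr (l - p) * E\<^sup>2 = 2 * (N powr (l + 2) * \<delta>\<^sup>2)" by simp
  also have "2 * N powr (l + 2) / c1\<^sup>2 * (2 * (\<theta> * \<delta>)\<^sup>2 + 2 * \<delta>\<^sup>2) + 2 * (N powr (l + 2) * \<delta>\<^sup>2) + 2 * K * (R * N powr (l + 2)) / c1\<^sup>2 * \<delta>\<^sup>2
     = error_const \<theta> c1 c2 \<kappa> K p l * (N powr (l + 2) * \<delta>\<^sup>2)"
    using pos by (simp add: error_const_def R_def field_simps power_mult_distrib)
  also have "N powr (l + 2) * \<delta>\<^sup>2 = (E powr ((2 + l) / (p + 2)) * \<delta> powr ((p - l) / (p + 2)))\<^sup>2"
  proof -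
    have a: "N powr (l + 2) = E powr (2 * (2 + l) / (p + 2)) / \<delta> powr (2 * (2 + l) / (p + 2))"
      using pos by (simp add: N_def powr_powr powr_divide add.commute)
    have b: "\<delta>\<^sup>2 = \<delta> powr (2 * (2 + l) / (p + 2)) * \<delta> powr (2 * ((p - l) / (p + 2)))"
    proof -
      have "2 * (2 + l) / (p + 2) + 2 * ((p - l) / (p + 2)) = (2 * (2 + l) + 2 * (p - l)) / (p + 2)"
        by (simp only: add_divide_distrib times_divide_eq_right)
      also have "2 * (2 + l) + 2 * (p - l) = 2 * (p + 2)" by simp
      also have "2 * (p + 2) / (p + 2) = 2" using pos by (intro nonzero_mult_div_cancel_right) auto
      finally have "2 * (2 + l) / (p + 2) + 2 * ((p - l) / (p + 2)) = 2" .
      then show ?thesis using pos by (simp flip: powr_add)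
    qed
    have "N powr (l + 2) * \<delta>\<^sup>2 = E powr (2 * (2 + l) / (p + 2)) * \<delta> powr (2 * ((p - l) / (p + 2)))"
      unfolding a b using pos by simp
    also have "\<dots> = (E powr ((2 + l) / (p + 2)) * \<delta> powr ((p - l) / (p + 2)))\<^sup>2"
      by (simp add: power2_eq_square flip: powr_add) (simp add: mult_ac flip: powr_add)
    finally show ?thesis .
  qed
  finally show ?thesis using int by blast
qed

section \<open>Bounds for the exponential filter and for the Mittag-Leffler factors\<close>

lemma exp_powr_bounded:
  fixes c s r :: real
  assumes "0 < c" "0 < s" "0 < r"
  shows "\<exists>K\<ge>0. \<forall>z\<ge>0. (1 + z\<^sup>2) powr r * exp (- c * z powr s) \<le> K"
proof -
  define Q where "Q = 2 * r / s"
  have Q: "0 < Q" using assms by (simp add: Q_def)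
  define K where "K = 2 powr r * max 1 ((Q / c) powr Q)"
  have K: "2 powr r \<le> K" "2 powr r * (Q / c) powr Q \<le> K"
    unfolding K_def by (simp_all add: max_def)
  have "(1 + z\<^sup>2) powr r * exp (- c * z powr s) \<le> K" if "0 \<le> z" for z
  proof (cases "z \<le> 1")
    case True
    have "z\<^sup>2 \<le> 1" using True that by (simp add: power_le_one)
    then have "(1 + z\<^sup>2) powr r * exp (- c * z powr s) \<le> 2 powr r * 1"
      using assms by (intro mult_mono powr_mono2) auto
    with K show ?thesis by simp
  next
    case False
    then have z: "1 < z" by simp
    define x where "x = z powr s"
    have x: "0 < x" using z by (simp add: x_def)
    have "1 + z\<^sup>2 \<le> 2 * z\<^sup>2" using z by (simp add: one_le_power)
    then have "(1 + z\<^sup>2) powr r \<le> (2 * z\<^sup>2) powr r" using assms by (intro powr_mono2) auto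
    also have "\<dots> = 2 powr r * z powr (2 * r)" using z by (simp add: powr_mult powr_powr flip: powr_numeral)
    also have "z powr (2 * r) = x powr Q" using assms by (simp add: x_def Q_def powr_powr)
    \<comment> \<open>Raised to the power Q, this produces exp (c x), which cancels the filter
      exactly; Q was chosen so that z^(2 r) = x^Q.\<close>
    also have "x \<le> Q / c * exp (c / Q * x)"
    proof -
      have "c / Q * x \<le> exp (c / Q * x)" using exp_ge_add_one_self[of "c / Q * x"] by linarith
      then show ?thesis using Q assms by (simp add: field_simps)
    qed
    then have "x powr Q \<le> (Q / c * exp (c / Q * x)) powr Q" using x Q by (intro powr_mono2) auto
    also have "\<dots> = (Q / c) powr Q * exp (c * x)"
      using Q by (subst powr_mult) (simp add: powr_def[of "exp _"])
    finally have "(1 + z\<^sup>2) powr r \<le> 2 powr r * ((Q / c) powr Q * exp (c * x))" by simp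
    then have "(1 + z\<^sup>2) powr r * exp (- c * z powr s) \<le> 2 powr r * ((Q / c) powr Q * exp (c * x)) * exp (- c * z powr s)"
      by (intro mult_right_mono) auto
    also have "\<dots> = 2 powr r * (Q / c) powr Q * (exp (c * x) * exp (- c * x))" by (simp add: x_def)
    also have "exp (c * x) * exp (- c * x) = 1" by (simp flip: exp_add)
    finally show ?thesis using K by simp
  qed
  moreover have "0 \<le> K" using K(1) by (rule order_trans[rotated]) simp
  ultimately show ?thesis by blast
qed

text \<open>Let Y be the quotient on the right. For Y \<ge> 1 it suffices that the left side is at
  most 1. For Y < 1 one has \<alpha> < 1, and z = \<alpha> r satisfies z^2 \<le> Y < 1, so 1 - exp
  (- x) \<le> x and z^s \<le> z^q finish. The latter uses q \<le> s, which in the application is p +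
  2 \<le> s.\<close>

lemma filter_lower:
  fixes \<alpha> \<tau> s q r :: real
  assumes "0 < \<alpha>" "0 < \<tau>" "0 < q" "q \<le> s" "0 \<le> r"
  shows "(1 - exp (- \<tau> * (\<alpha> * r) powr s))\<^sup>2 \<le> (max 1 \<tau>)\<^sup>2 * ((1 + r\<^sup>2) / max 1 (1 / \<alpha>\<^sup>2)) powr q"
proof -
  define Y where "Y = (1 + r\<^sup>2) / max 1 (1 / \<alpha>\<^sup>2)"
  define z where "z = \<alpha> * r"
  have z: "0 \<le> z" using assms by (simp add: z_def)
  have Y: "0 < Y" using assms by (auto simp: Y_def intro!: divide_pos_pos add_pos_nonneg)
  have le1: "1 - exp (- \<tau> * z powr s) \<le> 1" by simp
  have "1 - exp (- \<tau> * z powr s) \<le> max 1 \<tau> * Y powr (q / 2)"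
  proof (cases "1 \<le> Y")
    case True
    then have "1 \<le> Y powr (q / 2)" using assms by (intro ge_one_powr_ge_zero) auto
    then have "1 * 1 \<le> max 1 \<tau> * Y powr (q / 2)" by (intro mult_mono) auto
    with le1 show ?thesis by linarith
  next
    case False
    have a: "\<alpha> < 1"
    proof (rule ccontr)
      assume "\<not> \<alpha> < 1"
      then have "1 \<le> \<alpha>\<^sup>2" by (simp add: one_le_power)
      then have "1 / \<alpha>\<^sup>2 \<le> 1" by (simp add: divide_le_eq_1)
      then have "max 1 (1 / \<alpha>\<^sup>2) = 1" by (rule max_absorb1)
      with False show False by (simp add: Y_def)
    qed
    then have "\<alpha>\<^sup>2 \<le> 1" using assms by (simp add: power_le_one)
    then have "max 1 (1 / \<alpha>\<^sup>2) = 1 / \<alpha>\<^sup>2" using assms by (simp add: max_def field_simps)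
    then have "Y = \<alpha>\<^sup>2 + z\<^sup>2" by (simp add: Y_def z_def algebra_simps power_mult_distrib)
    then have zY: "z\<^sup>2 \<le> Y" by simp
    then have "z\<^sup>2 \<le> 1" using False by simp
    then have z1: "z \<le> 1" using power2_le_imp_le[of z 1] by simp
    have "1 - exp (- \<tau> * z powr s) \<le> \<tau> * z powr s"
      using exp_ge_add_one_self[of "- \<tau> * z powr s"] by simp
    also have "\<dots> \<le> \<tau> * z powr q" using assms z z1 by (intro mult_left_mono powr_mono') auto
    also have "z powr q = (z\<^sup>2) powr (q / 2)"
      using z by (cases "z = 0") (auto simp: powr_powr simp flip: powr_numeral)
    also have "\<tau> * (z\<^sup>2) powr (q / 2) \<le> max 1 \<tau> * Y powr (q / 2)"
      using assms zY by (intro mult_mono powr_mono2) auto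
    finally show ?thesis .
  qed
  then have "(1 - exp (- \<tau> * z powr s))\<^sup>2 \<le> (max 1 \<tau> * Y powr (q / 2))\<^sup>2"
    using assms by (intro power_mono) auto
  also have "\<dots> = (max 1 \<tau>)\<^sup>2 * Y powr q"
    by (simp add: power_mult_distrib power2_eq_square[of "Y powr _"] flip: powr_add)
  finally show ?thesis by (simp add: Y_def z_def)
qed

text \<open>The step 1 + r^2 \<le> A (1 + (\<alpha> r)^2) uses both A \<ge> 1 and A \<ge> 1 /
  \<alpha>^2, hence the maximum. It moves the weight to the variable \<alpha> r, in which the bound
  K is uniform in \<alpha>.\<close>

lemma filter_upper:
  fixes \<alpha> \<tau> s q r :: real
  assumes \<alpha>: "0 < \<alpha>" and q: "0 < q" and r: "0 \<le> r"
    and K: "\<And>z. 0 \<le> z \<Longrightarrow> (1 + z\<^sup>2) powr q * exp (- (2 * \<tau>) * z powr s) \<le> K"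
  shows "(exp (- \<tau> * (\<alpha> * r) powr s))\<^sup>2 * (1 + r\<^sup>2) powr q \<le> K * (max 1 (1 / \<alpha>\<^sup>2)) powr q"
proof -
  define A where "A = max 1 (1 / \<alpha>\<^sup>2)"
  define z where "z = \<alpha> * r"
  have z: "0 \<le> z" using \<alpha> r by (simp add: z_def)
  have "r\<^sup>2 = 1 / \<alpha>\<^sup>2 * z\<^sup>2" using \<alpha> by (simp add: z_def power_mult_distrib)
  also have "\<dots> \<le> A * z\<^sup>2" by (intro mult_right_mono) (auto simp: A_def)
  finally have "1 + r\<^sup>2 \<le> A * (1 + z\<^sup>2)" unfolding distrib_left by (intro add_mono) (auto simp: A_def)
  then have "(1 + r\<^sup>2) powr q \<le> (A * (1 + z\<^sup>2)) powr q" using q by (intro powr_mono2) auto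
  then have "(exp (- \<tau> * z powr s))\<^sup>2 * (1 + r\<^sup>2) powr q \<le> (exp (- \<tau> * z powr s))\<^sup>2 * (A * (1 + z\<^sup>2)) powr q"
    by (intro mult_left_mono) auto
  also have "\<dots> = ((1 + z\<^sup>2) powr q * exp (- (2 * \<tau>) * z powr s)) * A powr q"
    by (simp add: powr_mult power2_eq_square[of "exp _"] mult_ac flip: exp_add)
  also have "\<dots> \<le> K * A powr q" by (intro mult_right_mono K z) auto
  finally show ?thesis by (simp add: z_def A_def)
qed

text \<open>The maxima with 1 absorb the summand 1 of each denominator, so that both bounds become
  multiples of 1 / (1 + r), that is, of 1 / y.\<close>

lemma mittag_leffler_decay:
  fixes \<gamma> T r :: real
  assumes \<gamma>: "0 < \<gamma>" "\<gamma> < 1" and T: "0 < T" and r: "0 \<le> r"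
  shows "(1 / max 1 (Gamma (1 - \<gamma>) * T powr \<gamma>)) / (1 + r) \<le> mittag_leffler \<gamma> 1 (- (r * T powr \<gamma>))"
    and "mittag_leffler \<gamma> 1 (- (r * T powr \<gamma>)) \<le> max 1 (Gamma (1 + \<gamma>) / T powr \<gamma>) / (1 + r)"
proof -
  define a where "a = Gamma (1 - \<gamma>) * T powr \<gamma>"
  define b where "b = Gamma (1 + \<gamma>) / T powr \<gamma>"
  have a: "0 < a" and b: "0 < b" using \<gamma> T by (auto simp: a_def b_def intro!: mult_pos_pos divide_pos_pos Gamma_real_pos)
  have x: "0 \<le> r * T powr \<gamma>" using r by simp
  have "1 + a * r \<le> max 1 a * (1 + r)"
    unfolding distrib_left using r by (intro add_mono mult_right_mono) auto
  then have "1 / (max 1 a * (1 + r)) \<le> 1 / (1 + a * r)"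
    using a r by (intro divide_left_mono mult_pos_pos add_pos_nonneg) auto
  also have "\<dots> \<le> mittag_leffler \<gamma> 1 (- (r * T powr \<gamma>))"
    using mittag_leffler_bounds(1)[OF \<gamma> x] by (simp add: a_def mult_ac)
  finally show "(1 / max 1 (Gamma (1 - \<gamma>) * T powr \<gamma>)) / (1 + r) \<le> mittag_leffler \<gamma> 1 (- (r * T powr \<gamma>))"
    by (simp add: a_def)
  have "1 * r \<le> max 1 b / b * r" using r b by (intro mult_right_mono) (auto simp: field_simps)
  then have "1 + r \<le> max 1 b * (1 + r / b)"
    unfolding distrib_left by (intro add_mono) auto
  moreover have "0 < 1 + r / b" using r b by (intro add_pos_nonneg) auto
  ultimately have "1 / (1 + r / b) \<le> max 1 b / (1 + r)" using r by (simp add: field_simps)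
  moreover have "mittag_leffler \<gamma> 1 (- (r * T powr \<gamma>)) \<le> 1 / (1 + r / b)"
    using mittag_leffler_bounds(2)[OF \<gamma> x] by (simp add: b_def)
  ultimately show "mittag_leffler \<gamma> 1 (- (r * T powr \<gamma>)) \<le> max 1 (Gamma (1 + \<gamma>) / T powr \<gamma>) / (1 + r)"
    by (simp add: b_def)
qed

lemma mittag_leffler_in_unit:
  fixes \<gamma> x :: real
  assumes \<gamma>: "0 < \<gamma>" "\<gamma> < 1" and x: "0 \<le> x"
  shows "0 \<le> mittag_leffler \<gamma> 1 (- x)" "mittag_leffler \<gamma> 1 (- x) \<le> 1"
proof -
  have G: "0 < Gamma (1 - \<gamma>)" "0 < Gamma (1 + \<gamma>)" using \<gamma> by (auto intro!: Gamma_real_pos)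
  have "0 \<le> 1 / (1 + Gamma (1 - \<gamma>) * x)" using G x by simp
  also have "\<dots> \<le> mittag_leffler \<gamma> 1 (- x)" by (rule mittag_leffler_bounds(1)[OF assms])
  finally show "0 \<le> mittag_leffler \<gamma> 1 (- x)" .
  have "mittag_leffler \<gamma> 1 (- x) \<le> 1 / (1 + x / Gamma (1 + \<gamma>))" by (rule mittag_leffler_bounds(2)[OF assms])
  also have "\<dots> \<le> 1" using G x by (simp add: field_simps)
  finally show "mittag_leffler \<gamma> 1 (- x) \<le> 1" .
qed

section \<open>Norms in frequency space and the error estimate\<close>

lemma L2_norm_nonneg: "0 \<le> L2_norm f"
  by (simp add: L2_norm_def integral_nonneg_AE)

lemma L2_norm_power2: "(L2_norm f)\<^sup>2 = (LINT x|lborel. (cmod (f x))\<^sup>2)"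
  by (simp add: L2_norm_def integral_nonneg_AE)

lemma L2_norm_fourier_le:
  assumes "f \<in> L2"
  shows "L2_norm (fourier f) \<le> L2_norm f"
proof -
  have "ennreal ((L2_norm (fourier f))\<^sup>2) \<le> ennreal ((L2_norm f)\<^sup>2)"
    using sq_int_fourier_le[OF assms] sq_int_L2_norm[OF assms] sq_int_L2_norm[OF fourier_in_L2[OF assms]] by simp
  then have "(L2_norm (fourier f))\<^sup>2 \<le> (L2_norm f)\<^sup>2" by (simp add: L2_norm_nonneg)
  then show ?thesis by (rule power2_le_imp_le[OF _ L2_norm_nonneg])
qed

lemma cmod_sobolev_weighted:
  "(cmod (sobolev_weighted p f \<xi>))\<^sup>2 = (1 + (norm \<xi>)\<^sup>2) powr p * (cmod (fourier f \<xi>))\<^sup>2"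
  by (simp add: sobolev_weighted_def norm_mult power_mult_distrib power2_eq_square[of "_ powr _"] flip: powr_add)

lemma error_const_pos: "0 \<le> K \<Longrightarrow> 0 < error_const \<theta> c1 c2 \<kappa> K p l"
  unfolding error_const_def by (intro add_pos_nonneg add_nonneg_pos) auto

theorem theorem5:
  fixes \<gamma> T \<tau> s \<theta> p l :: real
  assumes "0 < \<gamma>" "\<gamma> < 1" and "0 < T" and "0 < \<tau>" and "0 < s" and "1 < \<theta>"
    and "0 < p" and "p + 2 \<le> s" and "0 \<le> l" "l \<le> p"
  shows "\<exists>C>0. \<forall>\<delta>>0. \<forall>E>0.
    \<forall>(g :: real^'n \<Rightarrow> complex) (g\<^sub>\<delta> :: real^'n \<Rightarrow> complex)
      (u :: real \<Rightarrow> real^'n \<Rightarrow> complex) (v :: real \<Rightarrow> real^'n \<Rightarrow> complex) (\<alpha> :: real).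
      g \<in> L2 \<longrightarrow> final_value_solution \<gamma> T g u \<longrightarrow>
      u 0 \<in> sobolev p \<longrightarrow> sobolev_norm p (u 0) \<le> E \<longrightarrow>
      g\<^sub>\<delta> \<in> L2 \<longrightarrow> L2_norm (\<lambda>x. g x - g\<^sub>\<delta> x) \<le> \<delta> \<longrightarrow>
      0 < \<theta> * \<delta> \<longrightarrow> \<theta> * \<delta> < L2_norm g\<^sub>\<delta> \<longrightarrow>
      0 < \<alpha> \<longrightarrow>
      L2_norm (\<lambda>\<xi>. complex_of_real (1 - exp (- \<tau> * (\<alpha> * norm \<xi>) powr s)) * fourier g\<^sub>\<delta> \<xi>)
        = \<theta> * \<delta> \<longrightarrow>
      regularized_solution \<gamma> T \<tau> s \<alpha> g\<^sub>\<delta> v \<longrightarrow>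
      (\<forall>t\<in>{0..T}.
         (\<lambda>x. u t x - v t x) \<in> sobolev l \<and>
         sobolev_norm l (\<lambda>x. u t x - v t x)
           \<le> C * E powr ((2 + l) / (p + 2)) * \<delta> powr ((p - l) / (p + 2)))"
proof -
  obtain K where K: "0 \<le> K"
    "\<And>z. 0 \<le> z \<Longrightarrow> (1 + z\<^sup>2) powr (l + 2) * exp (- (2 * \<tau>) * z powr s) \<le> K"
    using exp_powr_bounded[of "2 * \<tau>" s "l + 2"] assms by auto
  define c1 where "c1 = 1 / max 1 (Gamma (1 - \<gamma>) * T powr \<gamma>)"
  define c2 where "c2 = max 1 (Gamma (1 + \<gamma>) / T powr \<gamma>)"
  define \<kappa> where "\<kappa> = (max 1 \<tau>)\<^sup>2"
  have c1: "0 < c1" by (simp add: c1_def less_max_iff_disj)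
  have \<kappa>: "0 < \<kappa>" by (simp add: \<kappa>_def less_max_iff_disj)
  \<comment> \<open>All constants are fixed here, before \<delta>, E, t and the data. The witness is
    a square root because the abstract bound concerns the squared norm.\<close>
  define C0 where "C0 = error_const \<theta> c1 c2 \<kappa> K p l"
  have C0: "0 < C0" unfolding C0_def by (rule error_const_pos[OF K(1)])
  show ?thesis
  proof (intro exI[of _ "sqrt C0"] conjI allI impI ballI)
    show "0 < sqrt C0" using C0 by simp
    fix \<delta> E :: real and g g\<^sub>\<delta> :: "real^'n \<Rightarrow> complex" and u v :: "real \<Rightarrow> real^'n \<Rightarrow> complex" and \<alpha> t :: real
    assume \<delta>: "0 < \<delta>" and E: "0 < E" and g: "g \<in> L2" and sol: "final_value_solution \<gamma> T g u"
      and u0: "u 0 \<in> sobolev p" "sobolev_norm p (u 0) \<le> E"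
      and gd: "g\<^sub>\<delta> \<in> L2" "L2_norm (\<lambda>x. g x - g\<^sub>\<delta> x) \<le> \<delta>" and \<alpha>: "0 < \<alpha>"
      and disc: "L2_norm (\<lambda>\<xi>. complex_of_real (1 - exp (- \<tau> * (\<alpha> * norm \<xi>) powr s)) * fourier g\<^sub>\<delta> \<xi>) = \<theta> * \<delta>"
      and reg: "regularized_solution \<gamma> T \<tau> s \<alpha> g\<^sub>\<delta> v" and t: "t \<in> {0..T}"
    define y where "y \<xi> = 1 + (norm (\<xi>::real^'n))\<^sup>2" for \<xi>
    define e where "e \<xi> = mittag_leffler \<gamma> 1 (- (norm (\<xi>::real^'n))\<^sup>2 * T powr \<gamma>)" for \<xi>
    define e' where "e' \<xi> = mittag_leffler \<gamma> 1 (- (norm (\<xi>::real^'n))\<^sup>2 * t powr \<gamma>)" for \<xi>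
    define m where "m \<xi> = exp (- \<tau> * (\<alpha> * norm (\<xi>::real^'n)) powr s)" for \<xi>
    \<comment> \<open>Membership in \<open>sobolev l\<close> refers to the transform chosen for the
      difference itself; it agrees with the difference of the two transforms only almost
      everywhere.\<close>
    define F where "F = fourier (\<lambda>x. u t x - v t x)"
    have T: "T \<in> {0..T}" using assms by simp
    have uL2: "u t \<in> L2" "u T \<in> L2" and vL2: "v t \<in> L2"
      using sol reg t T by (auto simp: final_value_solution_def diffusion_solution_def regularized_solution_def)
    have dL2: "(\<lambda>x. u t x - v t x) \<in> L2" by (rule L2_diff[OF uL2(1) vL2])
    have m01: "0 \<le> m \<xi>" "m \<xi> \<le> 1" for \<xi> using assms by (auto simp: m_def)
    have hL2: "fourier g\<^sub>\<delta> \<in> L2" by (rule fourier_in_L2[OF gd(1)])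
    have ms: "fourier g\<^sub>\<delta> \<in> borel_measurable borel" "fourier g \<in> borel_measurable borel" "F \<in> borel_measurable borel"
      unfolding F_def using fourier_in_L2[OF dL2] hL2 fourier_in_L2[OF g] by (auto intro: L2_measurable)
    note [measurable] = ms
    have mm [measurable]: "m \<in> borel_measurable borel" "y \<in> borel_measurable borel"
      unfolding m_def y_def by measurable
    have dg: "(\<lambda>x. g x - g\<^sub>\<delta> x) \<in> L2" by (rule L2_diff[OF g gd(1)])
    have fd: "AE \<xi> in lborel. (cmod (fourier (\<lambda>x. g x - g\<^sub>\<delta> x) \<xi>))\<^sup>2 = (cmod (fourier g \<xi> - fourier g\<^sub>\<delta> \<xi>))\<^sup>2"
      using fourier_diff[OF g gd(1)] by eventually_elim simp
    have main: "integrable lborel (\<lambda>\<xi>. y \<xi> powr l * (cmod (F \<xi>))\<^sup>2) \<and>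
      (LINT \<xi>|lborel. y \<xi> powr l * (cmod (F \<xi>))\<^sup>2) \<le>
       error_const \<theta> c1 c2 \<kappa> K p l * (E powr ((2 + l) / (p + 2)) * \<delta> powr ((p - l) / (p + 2)))\<^sup>2"
    proof (rule filtered_error_bound[where A = "max 1 (1 / \<alpha>\<^sup>2)" and e = e and e' = e' and m = m
          and w = "fourier (u 0)" and h = "fourier g" and hd = "fourier g\<^sub>\<delta>"])
      show "c1 / y \<xi> \<le> e \<xi>" "e \<xi> \<le> c2 / y \<xi>" for \<xi>
        using mittag_leffler_decay[of \<gamma> T "(norm \<xi>)\<^sup>2"] assms
        by (auto simp: c1_def c2_def y_def e_def)
      show "0 \<le> e' \<xi>" "e' \<xi> \<le> 1" for \<xi>
        using mittag_leffler_in_unit[of \<gamma> "(norm \<xi>)\<^sup>2 * t powr \<gamma>"] assms by (auto simp: e'_def)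
      show "(1 - m \<xi>)\<^sup>2 \<le> \<kappa> * (y \<xi> / max 1 (1 / \<alpha>\<^sup>2)) powr (p + 2)" for \<xi>
        using filter_lower[of \<alpha> \<tau> "p + 2" s "norm \<xi>"] assms \<alpha> by (simp add: m_def \<kappa>_def y_def)
      show "(m \<xi>)\<^sup>2 * y \<xi> powr (l + 2) \<le> K * max 1 (1 / \<alpha>\<^sup>2) powr (l + 2)" for \<xi>
        unfolding m_def y_def by (rule filter_upper[OF \<alpha> _ _ K(2)]) (use assms in auto)
      have "AE \<xi> in lborel. fourier (u T) \<xi> = fourier (u 0) \<xi> * complex_of_real (e \<xi>)"
        using sol T unfolding final_value_solution_def diffusion_solution_def e_def by blast
      moreover have "AE \<xi> in lborel. fourier (u T) \<xi> = fourier g \<xi>"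
        using sol by (intro fourier_cong_AE uL2 g) (simp add: final_value_solution_def)
      ultimately show "AE \<xi> in lborel. fourier g \<xi> = fourier (u 0) \<xi> * complex_of_real (e \<xi>)"
        by eventually_elim simp
      have "AE \<xi> in lborel. fourier (u t) \<xi> = fourier (u 0) \<xi> * complex_of_real (e' \<xi>)"
        using sol t unfolding final_value_solution_def diffusion_solution_def e'_def by blast
      moreover have "AE \<xi> in lborel. fourier (v t) \<xi> = complex_of_real (e' \<xi> / e \<xi> * m \<xi>) * fourier g\<^sub>\<delta> \<xi>"
        using reg t unfolding regularized_solution_def e_def e'_def m_def by blast
      ultimately show "AE \<xi> in lborel. F \<xi> = fourier (u 0) \<xi> * complex_of_real (e' \<xi>) - complex_of_real (e' \<xi> / e \<xi> * m \<xi>) * fourier g\<^sub>\<delta> \<xi>"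
        unfolding F_def using fourier_diff[OF uL2(1) vL2] by eventually_elim simp
      show "integrable lborel (\<lambda>\<xi>. y \<xi> powr p * (cmod (fourier (u 0) \<xi>))\<^sup>2)"
        using u0(1) by (simp add: sobolev_def L2_def cmod_sobolev_weighted y_def)
      have "(sobolev_norm p (u 0))\<^sup>2 \<le> E\<^sup>2"
        using u0(2) by (intro power_mono) (auto simp: sobolev_norm_def L2_norm_nonneg)
      then show "(LINT \<xi>|lborel. y \<xi> powr p * (cmod (fourier (u 0) \<xi>))\<^sup>2) \<le> E\<^sup>2"
        by (simp add: sobolev_norm_def L2_norm_power2 cmod_sobolev_weighted y_def)
      show "integrable lborel (\<lambda>\<xi>. (cmod (fourier g \<xi> - fourier g\<^sub>\<delta> \<xi>))\<^sup>2)"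
        using L2_diff[OF fourier_in_L2[OF g] hL2] by (simp add: L2_def)
      \<comment> \<open>Here \<delta> passes from space to frequency, through the contraction
        property of the transform.\<close>
      have "(L2_norm (fourier (\<lambda>x. g x - g\<^sub>\<delta> x)))\<^sup>2 \<le> \<delta>\<^sup>2"
        using L2_norm_fourier_le[OF dg] gd(2) by (intro power_mono L2_norm_nonneg) auto
      moreover have "(LINT \<xi>|lborel. (cmod (fourier (\<lambda>x. g x - g\<^sub>\<delta> x) \<xi>))\<^sup>2) = (LINT \<xi>|lborel. (cmod (fourier g \<xi> - fourier g\<^sub>\<delta> \<xi>))\<^sup>2)"
        using L2_measurable[OF fourier_in_L2[OF dg]] by (intro integral_cong_AE fd) auto
      ultimately show "(LINT \<xi>|lborel. (cmod (fourier g \<xi> - fourier g\<^sub>\<delta> \<xi>))\<^sup>2) \<le> \<delta>\<^sup>2"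
        by (simp add: L2_norm_power2)
      show "integrable lborel (\<lambda>\<xi>. (1 - m \<xi>)\<^sup>2 * (cmod (fourier g\<^sub>\<delta> \<xi>))\<^sup>2)"
      proof (rule Bochner_Integration.integrable_bound)
        show "integrable lborel (\<lambda>\<xi>. (cmod (fourier g\<^sub>\<delta> \<xi>))\<^sup>2)" using hL2 by (simp add: L2_def)
        show "AE \<xi> in lborel. norm ((1 - m \<xi>)\<^sup>2 * (cmod (fourier g\<^sub>\<delta> \<xi>))\<^sup>2) \<le> norm ((cmod (fourier g\<^sub>\<delta> \<xi>))\<^sup>2)"
          using m01 by (auto simp: abs_mult power_le_one intro!: mult_left_le_one_le)
      qed measurable
      have "(LINT \<xi>|lborel. (1 - m \<xi>)\<^sup>2 * (cmod (fourier g\<^sub>\<delta> \<xi>))\<^sup>2) =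
         (LINT \<xi>|lborel. (cmod (complex_of_real (1 - exp (- \<tau> * (\<alpha> * norm \<xi>) powr s)) * fourier g\<^sub>\<delta> \<xi>))\<^sup>2)"
        unfolding m_def norm_mult norm_of_real power_mult_distrib power2_abs ..
      then show "(LINT \<xi>|lborel. (1 - m \<xi>)\<^sup>2 * (cmod (fourier g\<^sub>\<delta> \<xi>))\<^sup>2) = (\<theta> * \<delta>)\<^sup>2"
        unfolding L2_norm_power2[symmetric] disc .
    qed (use assms \<delta> E c1 \<kappa> K(1) m01 in \<open>auto simp: y_def less_max_iff_disj\<close>)
    have wm: "sobolev_weighted l (\<lambda>x. u t x - v t x) \<in> borel_measurable lborel"
      using ms(3) unfolding F_def sobolev_weighted_def by measurable
    show "(\<lambda>x. u t x - v t x) \<in> sobolev l"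
      using main dL2 wm by (simp add: sobolev_def L2_def cmod_sobolev_weighted y_def F_def)
    have "sobolev_norm l (\<lambda>x. u t x - v t x) = sqrt (LINT \<xi>|lborel. y \<xi> powr l * (cmod (F \<xi>))\<^sup>2)"
      by (simp add: sobolev_norm_def L2_norm_def cmod_sobolev_weighted y_def F_def)
    also have "\<dots> \<le> sqrt (C0 * (E powr ((2 + l) / (p + 2)) * \<delta> powr ((p - l) / (p + 2)))\<^sup>2)"
      using main unfolding C0_def by (intro real_sqrt_le_mono) auto
    also have "\<dots> = sqrt C0 * E powr ((2 + l) / (p + 2)) * \<delta> powr ((p - l) / (p + 2))"
      by (simp add: real_sqrt_mult)
    finally show "sobolev_norm l (\<lambda>x. u t x - v t x) \<le> sqrt C0 * E powr ((2 + l) / (p + 2)) * \<delta> powr ((p - l) / (p + 2))" .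
  qed
qed

end
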